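(* Let $c=(c_1,\dots,c_s)^{\intercal}$, $b=(b_1,\dots,b_s)^{\intercal}$, $A=(a_{ij})_{s\times s}$ be the (real) coefficients of an $s$-stage Runge-Kutta (RK) method, and let SEI denote the associated $s$-stage exponential integrator $$Y_i=e^{c_i hM}y_0+h\sum_{j=1}^{s}\bar a_{ij}(hM)f(Y_j),\quad i=1,\dots,s,\qquad y_1=e^{hM}y_0+h\sum_{i=1}^{s}\bar b_i(hM)f(Y_i),$$ with $$\bar a_{ij}(hM)=a_{ij}e^{(c_i-c_j)hM},\qquad \bar b_i(hM)=b_ie^{(1-c_i)hM},\qquad i,j=1,\dots,s.$$ Then: (1) If the RK method is symmetric, then the SEI is also symmetric. (2) The SEI is symplectic if the RK method is symplectic. (3) The SEI is symmetric and symplectic if the RK method is symmetric and symplectic. (4) If the RK method is of order $p$, then the SEI is also of order $p$.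
   Context: The integrators are for initial value problems $y'(t)=My(t)+f(y(t))$, $y(t_0)=y_0$, on $\mathbb{R}^d$, where $M$ is a $d\times d$ matrix, $f:\mathbb{R}^d\to\mathbb{R}^d$ is analytic, and $e^{tM}$ is the matrix exponential. An $s$-stage exponential integrator with stepsize $h$ is given by real constants $c_i$ and matrix-valued functions $\bar a_{ij}(Z),\bar b_i(Z)$ of a $d\times d$ matrix $Z$, evaluated at $Z=hM$, through the displayed stage and update equations. (For implicit schemes, $h$ is taken small enough that the stages are well defined, being the locally unique solution near $y_0$.) Symmetric exponential integrator: exchange $y_0\leftrightarrow y_1$ and replace $h$ by $-h$ in the scheme, writing $\widehat Y_i$ for the resulting stages; solve the update equation for $y_1$ and substitute it into the stage equations, so that $y_1$ and all $\widehat Y_i$ are expressed through $y_0$ and the $f(\widehat Y_j)$. The integrator is symmetric if, with $Y_i$ identified with $\widehat Y_{s+1-i}$ ($i=1,\dots,s$), the resulting scheme coincides with the original one, i.e. the coefficients multiplying $y_0$ and each $f(Y_j)$ agree in all equations as functions of the matrix $Z=hM$. Symmetric RK method: $c_i=1-c_{s+1-i}$, $a_{ij}=b_{s+1-j}-a_{s+1-i,s+1-j}$ and $b_i=b_{s+1-i}$ for all $i,j=1,\dots,s$. Symplectic RK method: $b_ib_j=b_ia_{ij}+b_ja_{ji}$ for all $i,j=1,\dots,s$. Symplectic exponential integrator: whenever the problem is Hamiltonian, i.e. $d$ is even, $J=\begin{pmatrix}0&I\\-I&0\end{pmatrix}$, $M=J^{-1}Q$ with $Q$ a symmetric matrix,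 and $f(y)=J^{-1}\nabla U(y)$ with $U$ a smooth potential function, the one-step map $\Phi_h:y_0\mapsto y_1$ is symplectic, i.e. $\Phi_h'(y_0)^{\intercal}J\,\Phi_h'(y_0)=J$. Order: a one-step method is of order $p$ if, for every sufficiently smooth problem of the class it is applied to, its local error after one step of size $h$ started from an exact value is $O(h^{p+1})$ as $h\to0$. For the RK method with coefficients $(c,b,A)$ the class is $y'=g(t,y)$, with stages $Y_i=y_0+h\sum_j a_{ij}g(t_0+c_jh,Y_j)$ and update $y_1=y_0+h\sum_i b_ig(t_0+c_ih,Y_i)$; for the exponential integrator it is the class $y'=My+f(y)$ (with $M$ fixed as $h\to 0$). *)

theory Defs
  imports "HOL-Analysis.Analysis" "HOL-Library.Landau_Symbols" "HOL-Library.FuncSet"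
begin

section \<open>Matrix exponential and differentiability classes\<close>

text \<open>The type class product on \<^typ>\<open>real^'n^'n\<close> is the componentwise one, so the library
  constant \<^const>\<open>exp\<close> is not the matrix exponential.\<close>

definition mexp :: "real^'n^'n \<Rightarrow> real^'n^'n" where
  "mexp Z = (\<Sum>k. inverse (fact k) *\<^sub>R (((**) Z) ^^ k) (mat 1))"

text \<open>For a finite-dimensional domain this is the usual class \<open>C\<^sup>k\<close>: the iterated directional
  derivatives up to order \<open>k\<close> exist and are continuous.\<close>

primrec ck :: "nat \<Rightarrow> ('a::euclidean_space \<Rightarrow> 'b::real_normed_vector) \<Rightarrow> bool" where
  "ck 0 f \<longleftrightarrow> continuous_on UNIV f"
| "ck (Suc k) f \<longleftrightarrow>
     (\<forall>x. f differentiable (at x)) \<and> (\<forall>v. ck k (\<lambda>x. frechet_derivative f (at x) v))"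

definition smooth :: "('a::euclidean_space \<Rightarrow> 'b::real_normed_vector) \<Rightarrow> bool" where
  "smooth f \<longleftrightarrow> (\<forall>k. ck k f)"

section \<open>Runge-Kutta methods\<close>

text \<open>Stages are numbered \<open>1, \<dots>, s\<close>; values of \<open>c\<close>, \<open>b\<close>, \<open>A\<close> at other indices are irrelevant.\<close>

definition rk_symmetric ::
  "nat \<Rightarrow> (nat \<Rightarrow> real) \<Rightarrow> (nat \<Rightarrow> real) \<Rightarrow> (nat \<Rightarrow> nat \<Rightarrow> real) \<Rightarrow> bool" where
  "rk_symmetric s c b A \<longleftrightarrow> (\<forall>i\<in>{1..s}. \<forall>j\<in>{1..s}.
     c i = 1 - c (s + 1 - i) \<and>
     A i j = b (s + 1 - j) - A (s + 1 - i) (s + 1 - j) \<and>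
     b i = b (s + 1 - i))"

definition rk_symplectic ::
  "nat \<Rightarrow> (nat \<Rightarrow> real) \<Rightarrow> (nat \<Rightarrow> nat \<Rightarrow> real) \<Rightarrow> bool" where
  "rk_symplectic s b A \<longleftrightarrow> (\<forall>i\<in>{1..s}. \<forall>j\<in>{1..s}. b i * b j = b i * A i j + b j * A j i)"

text \<open>The stages are the locally unique solution near \<open>y0\<close>: they are sought in the ball of
  radius \<open>r\<close> around \<open>y0\<close>. The extensional function space makes \<open>\<exists>!\<close> meaningful.\<close>

definition rk_stages ::
  "nat \<Rightarrow> (nat \<Rightarrow> real) \<Rightarrow> (nat \<Rightarrow> nat \<Rightarrow> real) \<Rightarrow> (real \<Rightarrow> real^'n \<Rightarrow> real^'n) \<Rightarrow>
   real \<Rightarrow> real \<Rightarrow> real \<Rightarrow> real^'n \<Rightarrow> (nat \<Rightarrow> real^'n) \<Rightarrow> bool" where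
  "rk_stages s c A g r h t0 y0 Y \<longleftrightarrow>
     Y \<in> {1..s} \<rightarrow>\<^sub>E ball y0 r \<and>
     (\<forall>i\<in>{1..s}. Y i = y0 + h *\<^sub>R (\<Sum>j=1..s. A i j *\<^sub>R g (t0 + c j * h) (Y j)))"

definition rk_step ::
  "nat \<Rightarrow> (nat \<Rightarrow> real) \<Rightarrow> (nat \<Rightarrow> real) \<Rightarrow> (nat \<Rightarrow> nat \<Rightarrow> real) \<Rightarrow>
   (real \<Rightarrow> real^'n \<Rightarrow> real^'n) \<Rightarrow> real \<Rightarrow> real \<Rightarrow> real \<Rightarrow> real^'n \<Rightarrow> real^'n" where
  "rk_step s c b A g r h t0 y0 =
     (let Y = (THE Y. rk_stages s c A g r h t0 y0 Y)
      in y0 + h *\<^sub>R (\<Sum>i=1..s. b i *\<^sub>R g (t0 + c i * h) (Y i)))"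

text \<open>Order \<open>p\<close> for problems on \<^typ>\<open>real^'n\<close>. ``Sufficiently smooth'' means \<open>C\<^sup>k\<close> for some
  \<open>k\<close> that does not depend on the problem. The exact solution \<open>y\<close> need only exist near \<open>t0\<close>.\<close>

definition rk_order ::
  "'n::finite itself \<Rightarrow> nat \<Rightarrow> (nat \<Rightarrow> real) \<Rightarrow> (nat \<Rightarrow> real) \<Rightarrow> (nat \<Rightarrow> nat \<Rightarrow> real) \<Rightarrow>
   nat \<Rightarrow> bool" where
  "rk_order _ s c b A p \<longleftrightarrow>
     (\<exists>k. \<forall>(g :: real \<Rightarrow> real^'n \<Rightarrow> real^'n) y t0 \<epsilon>.
        ck k (\<lambda>(t, x). g t x) \<longrightarrow> \<epsilon> > 0 \<longrightarrow>
        (\<forall>t\<in>{t0 - \<epsilon><..<t0 + \<epsilon>}. (y has_vector_derivative g t (y t)) (at t)) \<longrightarrow>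
        (\<exists>r>0. (\<forall>\<^sub>F h in at 0. \<exists>!Y. rk_stages s c A g r h t0 (y t0) Y) \<and>
               (\<lambda>h. norm (rk_step s c b A g r h t0 (y t0) - y (t0 + h)))
                 \<in> O[at 0](\<lambda>h. h ^ (p + 1))))"

section \<open>Exponential integrators\<close>

text \<open>A scheme
    \<open>Y\<^sub>i = P\<^sub>i(Z) y\<^sub>0 + h \<Sum>\<^sub>j \<alpha>\<^sub>i\<^sub>j(Z) f(Y\<^sub>j)\<close>,  \<open>y\<^sub>1 = P(Z) y\<^sub>0 + h \<Sum>\<^sub>i \<beta>\<^sub>i(Z) f(Y\<^sub>i)\<close>
  with \<open>Z = h M\<close> is given by its coefficients; \<open>P\<^sub>i\<close>, \<open>\<alpha>\<^sub>i\<^sub>j\<close>, \<open>P\<close>, \<open>\<beta>\<^sub>i\<close> are the fields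
  \<open>stage_y\<close>, \<open>stage_f\<close>, \<open>update_y\<close>, \<open>update_f\<close>.\<close>

record ('n::finite) scheme =
  nstages :: nat
  stage_y :: "nat \<Rightarrow> real^'n^'n \<Rightarrow> real^'n^'n"
  stage_f :: "nat \<Rightarrow> nat \<Rightarrow> real^'n^'n \<Rightarrow> real^'n^'n"
  update_y :: "real^'n^'n \<Rightarrow> real^'n^'n"
  update_f :: "nat \<Rightarrow> real^'n^'n \<Rightarrow> real^'n^'n"

definition exp_integrator ::
  "nat \<Rightarrow> (nat \<Rightarrow> real) \<Rightarrow> (nat \<Rightarrow> nat \<Rightarrow> real^'n^'n \<Rightarrow> real^'n^'n) \<Rightarrow>
   (nat \<Rightarrow> real^'n^'n \<Rightarrow> real^'n^'n) \<Rightarrow> 'n::finite scheme" where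
  "exp_integrator s c abar bbar =
     \<lparr>nstages = s, stage_y = (\<lambda>i Z. mexp (c i *\<^sub>R Z)), stage_f = abar,
      update_y = mexp, update_f = bbar\<rparr>"

definition SEI ::
  "nat \<Rightarrow> (nat \<Rightarrow> real) \<Rightarrow> (nat \<Rightarrow> real) \<Rightarrow> (nat \<Rightarrow> nat \<Rightarrow> real) \<Rightarrow> 'n::finite scheme" where
  "SEI s c b A = exp_integrator s c
     (\<lambda>i j Z. A i j *\<^sub>R mexp ((c i - c j) *\<^sub>R Z))
     (\<lambda>i Z. b i *\<^sub>R mexp ((1 - c i) *\<^sub>R Z))"

definition stage_eqs ::
  "'n::finite scheme \<Rightarrow> real^'n^'n \<Rightarrow> (real^'n \<Rightarrow> real^'n) \<Rightarrow> real \<Rightarrow> real^'n \<Rightarrow>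
   (nat \<Rightarrow> real^'n) \<Rightarrow> bool" where
  "stage_eqs S M f h y0 Y \<longleftrightarrow> (\<forall>i\<in>{1..nstages S}.
     Y i = stage_y S i (h *\<^sub>R M) *v y0
           + h *\<^sub>R (\<Sum>j=1..nstages S. stage_f S i j (h *\<^sub>R M) *v f (Y j)))"

definition update ::
  "'n::finite scheme \<Rightarrow> real^'n^'n \<Rightarrow> (real^'n \<Rightarrow> real^'n) \<Rightarrow> real \<Rightarrow> real^'n \<Rightarrow>
   (nat \<Rightarrow> real^'n) \<Rightarrow> real^'n" where
  "update S M f h y0 Y = update_y S (h *\<^sub>R M) *v y0
     + h *\<^sub>R (\<Sum>i=1..nstages S. update_f S i (h *\<^sub>R M) *v f (Y i))"

definition ei_stages ::
  "'n::finite scheme \<Rightarrow> real^'n^'n \<Rightarrow> (real^'n \<Rightarrow> real^'n) \<Rightarrow> real \<Rightarrow> real \<Rightarrow> real^'n \<Rightarrow>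
   (nat \<Rightarrow> real^'n) \<Rightarrow> bool" where
  "ei_stages S M f r h y0 Y \<longleftrightarrow>
     Y \<in> {1..nstages S} \<rightarrow>\<^sub>E ball y0 r \<and> stage_eqs S M f h y0 Y"

definition ei_step ::
  "'n::finite scheme \<Rightarrow> real^'n^'n \<Rightarrow> (real^'n \<Rightarrow> real^'n) \<Rightarrow> real \<Rightarrow> real \<Rightarrow> real^'n \<Rightarrow> real^'n" where
  "ei_step S M f r h y0 = update S M f h y0 (THE Y. ei_stages S M f r h y0 Y)"

definition ei_order :: "'n::finite scheme \<Rightarrow> nat \<Rightarrow> bool" where
  "ei_order S p \<longleftrightarrow>
     (\<exists>k. \<forall>(M :: real^'n^'n) f y t0 \<epsilon>.
        ck k f \<longrightarrow> \<epsilon> > 0 \<longrightarrow>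
        (\<forall>t\<in>{t0 - \<epsilon><..<t0 + \<epsilon>}. (y has_vector_derivative (M *v y t + f (y t))) (at t)) \<longrightarrow>
        (\<exists>r>0. (\<forall>\<^sub>F h in at 0. \<exists>!Y. ei_stages S M f r h (y t0) Y) \<and>
               (\<lambda>h. norm (ei_step S M f r h (y t0) - y (t0 + h)))
                 \<in> O[at 0](\<lambda>h. h ^ (p + 1))))"

subsection \<open>Symmetry\<close>

text \<open>After exchanging \<open>y\<^sub>0\<close> and \<open>y\<^sub>1\<close> and replacing \<open>h\<close> by \<open>-h\<close>, the scheme reads
    \<open>Y\<^sub>i = P\<^sub>i(-Z) y\<^sub>1 - h \<Sum>\<^sub>j \<alpha>\<^sub>i\<^sub>j(-Z) f(Y\<^sub>j)\<close>,  \<open>y\<^sub>0 = P(-Z) y\<^sub>1 - h \<Sum>\<^sub>i \<beta>\<^sub>i(-Z) f(Y\<^sub>i)\<close>.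
  \<open>reversed\<close> gives these coefficients (with \<open>y\<^sub>1\<close> in the role of the known value); \<open>solved\<close>
  solves the last equation for the known value and substitutes it into the stages.\<close>

definition reversed :: "'n::finite scheme \<Rightarrow> 'n scheme" where
  "reversed S =
     \<lparr>nstages = nstages S,
      stage_y = (\<lambda>i Z. stage_y S i (- Z)),
      stage_f = (\<lambda>i j Z. - stage_f S i j (- Z)),
      update_y = (\<lambda>Z. update_y S (- Z)),
      update_f = (\<lambda>i Z. - update_f S i (- Z))\<rparr>"

definition solved :: "'n::finite scheme \<Rightarrow> 'n scheme" where
  "solved S =
     \<lparr>nstages = nstages S,
      stage_y = (\<lambda>i Z. stage_y S i Z ** matrix_inv (update_y S Z)),
      stage_f = (\<lambda>i j Z. stage_f S i j Z
                    - stage_y S i Z ** (matrix_inv (update_y S Z) ** update_f S j Z)),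
      update_y = (\<lambda>Z. matrix_inv (update_y S Z)),
      update_f = (\<lambda>i Z. - (matrix_inv (update_y S Z) ** update_f S i Z))\<rparr>"

definition renumbered :: "'n::finite scheme \<Rightarrow> 'n scheme" where
  "renumbered S =
     \<lparr>nstages = nstages S,
      stage_y = (\<lambda>i. stage_y S (nstages S + 1 - i)),
      stage_f = (\<lambda>i j. stage_f S (nstages S + 1 - i) (nstages S + 1 - j)),
      update_y = update_y S,
      update_f = (\<lambda>i. update_f S (nstages S + 1 - i))\<rparr>"

definition adjoint_scheme :: "'n::finite scheme \<Rightarrow> 'n scheme" where
  "adjoint_scheme S = renumbered (solved (reversed S))"

definition ei_symmetric :: "'n::finite scheme \<Rightarrow> bool" where
  "ei_symmetric S \<longleftrightarrow> (\<forall>Z.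
     update_y (adjoint_scheme S) Z = update_y S Z \<and>
     (\<forall>i\<in>{1..nstages S}.
        stage_y (adjoint_scheme S) i Z = stage_y S i Z \<and>
        update_f (adjoint_scheme S) i Z = update_f S i Z \<and>
        (\<forall>j\<in>{1..nstages S}. stage_f (adjoint_scheme S) i j Z = stage_f S i j Z)))"

lemma adjoint_scheme_correct:
  fixes S :: "'n::finite scheme"
  assumes inv: "invertible (update_y S (- (h *\<^sub>R M)))"
  shows "stage_eqs S M f (- h) y1 Y \<and> y0 = update S M f (- h) y1 Y \<longleftrightarrow>
         stage_eqs (adjoint_scheme S) M f h y0 (\<lambda>i. Y (nstages S + 1 - i)) \<and>
         y1 = update (adjoint_scheme S) M f h y0 (\<lambda>i. Y (nstages S + 1 - i))"
proof -
  define s Z P B where "s = nstages S" and "Z = h *\<^sub>R M" and "P = update_y S (- Z)"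
    and "B = (\<Sum>j=1..s. update_f S j (- Z) *v f (Y j))"
  define a where "a = (\<lambda>i. \<Sum>j=1..s. stage_f S i j (- Z) *v f (Y j))"
  define p where "p = (\<lambda>i. stage_y S i (- Z))"
  have neg: "(- h) *\<^sub>R M = - Z"
    by (simp add: Z_def)
  have mv_minus: "(- N) *v x = - (N *v x)" for N :: "real^'n^'n" and x
    by (simp add: matrix_vector_mult_def vec_eq_iff sum_negf)
  have mult_minus: "N ** (- N') = - (N ** N')" for N N' :: "real^'n^'n"
    by (simp add: matrix_matrix_mult_def vec_eq_iff sum_negf)
  have mv_sum: "N *v sum u I = (\<Sum>j\<in>I. N *v u j)" for N :: "real^'n^'n" and u and I :: "nat set"
    by (rule linear_sum) simp
  have mv_scale: "N *v (r *\<^sub>R x) = r *\<^sub>R (N *v x)" for N :: "real^'n^'n" and r x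
    by (simp add: matrix_vector_mult_scaleR)
  have rev: "(\<Sum>j=1..s. u (s + 1 - j)) = (\<Sum>j=1..s. u j)" for u :: "nat \<Rightarrow> real^'n"
    by (rule sum.atLeastAtMost_rev [symmetric])
  have ball_rev: "(\<forall>i\<in>{1..s}. R (s + 1 - i)) \<longleftrightarrow> (\<forall>i\<in>{1..s}. R i)" for R
  proof
    assume *: "\<forall>i\<in>{1..s}. R (s + 1 - i)"
    show "\<forall>i\<in>{1..s}. R i"
    proof
      fix i assume "i \<in> {1..s}"
      then have "s + 1 - i \<in> {1..s}" "s + 1 - (s + 1 - i) = i" by auto
      then show "R i" using * by metis
    qed
  next
    assume *: "\<forall>i\<in>{1..s}. R i"
    show "\<forall>i\<in>{1..s}. R (s + 1 - i)"
    proof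
      fix i assume "i \<in> {1..s}"
      then have "s + 1 - i \<in> {1..s}" by auto
      then show "R (s + 1 - i)" using * by blast
    qed
  qed
  have PP: "matrix_inv P ** P = mat 1" "P ** matrix_inv P = mat 1"
    using someI_ex [OF inv [unfolded invertible_def]] by (simp_all add: matrix_inv_def P_def Z_def)
  have lhs: "stage_eqs S M f (- h) y1 Y \<and> y0 = update S M f (- h) y1 Y \<longleftrightarrow>
      (\<forall>i\<in>{1..s}. Y i = p i *v y1 - h *\<^sub>R a i) \<and> y0 = P *v y1 - h *\<^sub>R B"
    by (simp add: stage_eqs_def update_def neg Z_def [symmetric] s_def [symmetric] P_def B_def a_def p_def)
  have upd: "update (adjoint_scheme S) M f h y0 (\<lambda>i. Y (s + 1 - i))
      = matrix_inv P *v y0 + h *\<^sub>R (matrix_inv P *v B)"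
  proof -
    have "(\<Sum>i=1..s. (matrix_inv P ** update_f S (s + 1 - i) (- Z)) *v f (Y (s + 1 - i)))
        = matrix_inv P *v B"
      using rev [of "\<lambda>i. (matrix_inv P ** update_f S i (- Z)) *v f (Y i)"]
      by (simp add: B_def mv_sum matrix_vector_mul_assoc)
    then show ?thesis
      by (simp add: update_def adjoint_scheme_def renumbered_def solved_def reversed_def
          s_def [symmetric] Z_def [symmetric] P_def [symmetric] mult_minus)
  qed
  have stg: "stage_f (adjoint_scheme S) i j Z
      = p (s + 1 - i) ** (matrix_inv P ** update_f S (s + 1 - j) (- Z))
        - stage_f S (s + 1 - i) (s + 1 - j) (- Z)" for i j
    by (simp add: adjoint_scheme_def renumbered_def solved_def reversed_def
        s_def [symmetric] P_def [symmetric] p_def mult_minus)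
  have stgs: "(\<Sum>j=1..s. stage_f (adjoint_scheme S) i j Z *v f (Y (s + 1 - j)))
      = p (s + 1 - i) *v (matrix_inv P *v B) - a (s + 1 - i)" for i
    unfolding stg
    using rev [of "\<lambda>j. (p (s + 1 - i) ** (matrix_inv P ** update_f S j (- Z))
        - stage_f S (s + 1 - i) j (- Z)) *v f (Y j)"]
    by (simp add: a_def B_def mv_sum matrix_vector_mul_assoc matrix_vector_mult_diff_rdistrib
        sum_subtractf)
  have ns: "nstages (adjoint_scheme S) = s"
    and sy: "stage_y (adjoint_scheme S) i Z = p (s + 1 - i) ** matrix_inv P" for i
    by (simp_all add: adjoint_scheme_def renumbered_def solved_def reversed_def s_def P_def p_def)
  define R where "R = (\<lambda>i. Y i = p i *v (matrix_inv P *v y0 + h *\<^sub>R (matrix_inv P *v B)) - h *\<^sub>R a i)"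
  have "stage_eqs (adjoint_scheme S) M f h y0 (\<lambda>i. Y (s + 1 - i)) \<longleftrightarrow> (\<forall>i\<in>{1..s}. R (s + 1 - i))"
    unfolding stage_eqs_def ns Z_def [symmetric] sy stgs R_def
    by (simp add: matrix_vector_right_distrib mv_scale matrix_vector_mul_assoc [symmetric]
        scaleR_diff_right algebra_simps)
  then have rhs: "stage_eqs (adjoint_scheme S) M f h y0 (\<lambda>i. Y (s + 1 - i)) \<longleftrightarrow> (\<forall>i\<in>{1..s}. R i)"
    using ball_rev by simp
  have "y0 = P *v y1 - h *\<^sub>R B \<longleftrightarrow> y1 = matrix_inv P *v y0 + h *\<^sub>R (matrix_inv P *v B)" (is "?l = ?r")
  proof
    assume ?l
    then have "matrix_inv P *v (y0 + h *\<^sub>R B) = y1"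
      by (simp add: matrix_vector_mul_assoc PP)
    then show ?r
      by (simp add: matrix_vector_right_distrib mv_scale)
  next
    assume ?r
    then have "P *v y1 = P *v (matrix_inv P *v (y0 + h *\<^sub>R B))"
      by (simp add: matrix_vector_right_distrib mv_scale)
    then show ?l
      by (simp add: matrix_vector_mul_assoc PP)
  qed
  then show ?thesis
    unfolding lhs s_def [symmetric] upd rhs R_def by auto
qed

subsection \<open>Symplecticity\<close>

definition J_mat :: "real^('m::finite + 'm)^('m + 'm)" where
  "J_mat = (\<chi> i j. case (i, j) of
      (Inl k, Inr l) \<Rightarrow> if k = l then 1 else 0
    | (Inr k, Inl l) \<Rightarrow> if k = l then - 1 else 0
    | _ \<Rightarrow> 0)"

text \<open>For small \<open>h\<close>, the one-step map \<open>\<Phi>\<^sub>h\<close> is well defined in a neighbourhood of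
  each \<open>y0\<close>, and differentiable with symplectic Jacobian at \<open>y0\<close>.\<close>

definition ei_symplectic :: "('m::finite + 'm) scheme \<Rightarrow> bool" where
  "ei_symplectic S \<longleftrightarrow>
     (\<forall>(Q :: real^('m + 'm)^('m + 'm)) (U :: real^('m + 'm) \<Rightarrow> real) gradU M f.
        transpose Q = Q \<longrightarrow> smooth U \<longrightarrow> (\<forall>y. GDERIV U y :> gradU y) \<longrightarrow>
        M = matrix_inv J_mat ** Q \<longrightarrow> f = (\<lambda>y. matrix_inv J_mat *v gradU y) \<longrightarrow>
        (\<forall>y0. \<exists>r>0. \<forall>\<^sub>F h in at 0.
           (\<forall>\<^sub>F y in nhds y0. \<exists>!Y. ei_stages S M f r h y Y) \<and>
           ei_step S M f r h differentiable (at y0) \<and>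
           transpose (jacobian (ei_step S M f r h) (at y0)) ** J_mat **
             jacobian (ei_step S M f r h) (at y0) = J_mat))"

end

theory Submission
  imports Defs
begin

text \<open>
  The idea behind the whole theorem is the substitution \<open>y(t) = e\<^sup>t\<^sup>M z(t)\<close>. It turns \<open>y' = M y + f(y)\<close>
  into \<open>z' = e\<^sup>-\<^sup>t\<^sup>M f(e\<^sup>t\<^sup>M z)\<close>, and the exponential integrator is exactly what the Runge-Kutta method
  becomes under it: if \<open>Y\<^sub>i\<close> are the stages of the integrator, then \<open>Z\<^sub>i = e\<^bsup>-c\<^sub>i h M\<^esup> Y\<^sub>i\<close> are Runge-Kutta
  stages for the transformed problem, and the new value is \<open>e\<^sup>h\<^sup>M\<close> applied to the Runge-Kutta result.
  So properties of the Runge-Kutta method carry over.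

  \<^item> Symmetry (\<open>SEI_symmetric\<close>) is a computation with the coefficients: only the law
    \<open>e\<^sup>a\<^sup>Z e\<^sup>b\<^sup>Z = e\<^bsup>(a+b)Z\<^esup>\<close> is needed to reduce it to the symmetry of \<open>c\<close>, \<open>b\<close>, \<open>A\<close>.

  \<^item> Symplecticity (\<open>SEI_symplectic\<close>): the derivatives of the stages with respect to the initial
    value solve the linearised stage equations. In the transformed variables these are Runge-Kutta
    equations for a linear problem with Hamiltonian coefficients, since \<open>e\<^sup>t\<^sup>M\<close> preserves the
    symplectic form. A symplectic Runge-Kutta method preserves every bilinear form that is invariant
    under the problem (\<open>symplectic_rk_preserves_bilinear\<close>). That the derivative of a
    Hamiltonian vector field is Hamiltonian is the symmetry of the Hessian
    (\<open>gradient_derivative_symmetric\<close>).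

  \<^item> Order (\<open>SEI_order\<close>): the transformed vector field is as smooth as \<open>f\<close>, so the
    Runge-Kutta method has local error \<open>O(h\<^bsup>p+1\<^esup>)\<close> on it, and \<open>e\<^sup>h\<^sup>M\<close> is bounded as \<open>h \<rightarrow> 0\<close>.

  The last two parts need that the implicit stages exist and are unique near the initial value;
  symplecticity also needs that they depend differentiably on it. This is the locale \<open>stage_system\<close>, which rests on a contraction
  argument for finite families (\<open>contraction_family_fixpoint\<close>) with constants that are uniform in the
  initial value.
\<close>

section \<open>The matrix exponential\<close>

lemma mat_pow_scaleR:
  fixes Z :: "real^'n^'n"
  shows "(((**) (t *\<^sub>R Z)) ^^ k) B = t ^ k *\<^sub>R (((**) Z) ^^ k) B"
  by (induct k)
    (simp_all add: matrix_matrix_mult_def vec_eq_iff sum_distrib_left sum_distrib_right mult_ac)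

text \<open>A crude bound on the entries of the powers is enough: it dominates the entries of the exponential
  series by a scalar exponential series, so everything can be done entry by entry with real power
  series.\<close>

lemma mat_pow_bound:
  fixes Z :: "real^'n^'n"
  shows "\<bar>(((**) Z) ^^ k) (mat 1) $ i $ j\<bar> \<le> (of_nat CARD('n) * norm Z) ^ k"
proof (induct k arbitrary: i j)
  case 0
  show ?case by (simp add: mat_def)
next
  case (Suc k)
  let ?B = "(((**) Z) ^^ k) (mat 1)"
  let ?K = "of_nat CARD('n) * norm Z"
  have Zij: "\<bar>Z $ i $ l\<bar> \<le> norm Z" for l
    using component_le_norm_cart [of "Z $ i" l] Finite_Cartesian_Product.norm_nth_le [of Z i]
    by linarith
  have "\<bar>(((**) Z) ^^ Suc k) (mat 1) $ i $ j\<bar> = \<bar>\<Sum>l\<in>UNIV. Z $ i $ l * ?B $ l $ j\<bar>"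
    by (simp add: matrix_matrix_mult_def)
  also have "\<dots> \<le> (\<Sum>l\<in>(UNIV :: 'n set). norm Z * ?K ^ k)"
    by (rule order_trans [OF sum_abs], rule sum_mono)
      (simp add: abs_mult mult_mono Zij Suc)
  finally show ?case by simp
qed

lemma mexp_entry_summable:
  fixes Z :: "real^'n^'n"
  shows "summable (\<lambda>k. (((**) Z) ^^ k) (mat 1) $ i $ j / fact k * t ^ k)"
proof (rule summable_comparison_test' [where N = 0])
  let ?K = "of_nat CARD('n) * norm Z"
  show "summable (\<lambda>k. inverse (fact k) * (?K * \<bar>t\<bar>) ^ k)"
    by (rule summable_exp)
  fix k
  show "norm ((((**) Z) ^^ k) (mat 1) $ i $ j / fact k * t ^ k)
      \<le> inverse (fact k) * (?K * \<bar>t\<bar>) ^ k"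
    using mult_right_mono [OF mat_pow_bound [of k Z i j], of "\<bar>t\<bar> ^ k"]
    by (simp add: abs_mult power_abs power_mult_distrib field_simps)
qed

lemma mexp_sums_entries:
  fixes Z :: "real^'n^'n"
  shows "(\<lambda>k. inverse (fact k) *\<^sub>R (((**) (t *\<^sub>R Z)) ^^ k) (mat 1)) sums
    (\<chi> i j. \<Sum>k. (((**) Z) ^^ k) (mat 1) $ i $ j / fact k * t ^ k)"
    (is "?f sums (\<chi> i j. \<Sum>k. ?a i j k)")
  unfolding sums_def
proof (rule vec_tendstoI, rule vec_tendstoI)
  fix i j
  have "?a i j sums (\<Sum>k. ?a i j k)"
    by (rule summable_sums [OF mexp_entry_summable])
  then show "(\<lambda>n. (\<Sum>k<n. ?f k) $ i $ j) \<longlonglongrightarrow> (\<chi> i j. \<Sum>k. ?a i j k) $ i $ j"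
    by (simp add: sums_def mat_pow_scaleR field_simps)
qed

lemma mexp_entry:
  fixes Z :: "real^'n^'n"
  shows "mexp (t *\<^sub>R Z) $ i $ j = (\<Sum>k. (((**) Z) ^^ k) (mat 1) $ i $ j / fact k * t ^ k)"
  unfolding mexp_def by (simp add: sums_unique [OF mexp_sums_entries, symmetric])

lemma mexp_sums: "(\<lambda>k. inverse (fact k) *\<^sub>R (((**) Z) ^^ k) (mat 1)) sums mexp (Z :: real^'n^'n)"
  unfolding mexp_def using mexp_sums_entries [of 1 Z] by (simp add: sums_iff)

lemma has_vector_derivative_matrixI:
  fixes F :: "real \<Rightarrow> real^'n^'m"
  assumes "\<And>i j. ((\<lambda>t. F t $ i $ j) has_field_derivative F' $ i $ j) (at t)"
  shows "(F has_vector_derivative F') (at t)"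
  unfolding has_vector_derivative_def
proof (subst has_derivative_componentwise_within, intro ballI)
  fix B :: "real^'n^'m"
  assume "B \<in> Basis"
  then obtain i j where B: "B = axis i (axis j 1)"
    by (auto simp: Basis_vec_def)
  show "((\<lambda>t. F t \<bullet> B) has_derivative (\<lambda>h. (h *\<^sub>R F') \<bullet> B)) (at t)"
    using assms [of i j, unfolded has_field_derivative_def]
    by (simp add: B inner_axis mult.commute [of _ "F' $ i $ j"])
qed

lemma mexp_has_vector_derivative:
  fixes Z :: "real^'n^'n"
  shows "((\<lambda>t. mexp (t *\<^sub>R Z)) has_vector_derivative Z ** mexp (t *\<^sub>R Z)) (at t)"
proof (rule has_vector_derivative_matrixI)
  fix i j :: 'n
  define a where "a = (\<lambda>i j k. (((**) Z) ^^ k) (mat 1) $ i $ j / fact k)"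
  have sm: "summable (\<lambda>k. a i j k * t ^ k)" for i j t
    unfolding a_def by (rule mexp_entry_summable)
  have e: "mexp (t *\<^sub>R Z) $ i $ j = (\<Sum>k. a i j k * t ^ k)" for i j t
    unfolding a_def by (rule mexp_entry)
  have "diffs (a i j) k = (Z ** (((**) Z) ^^ k) (mat 1)) $ i $ j / fact k" for k
    by (simp add: diffs_def a_def del: of_nat_Suc)
  then have d: "diffs (a i j) k = (\<Sum>l\<in>UNIV. Z $ i $ l * a l j k)" for k
    by (simp add: a_def matrix_matrix_mult_def sum_divide_distrib)
  have "(\<Sum>k. diffs (a i j) k * t ^ k) = (\<Sum>k. \<Sum>l\<in>UNIV. Z $ i $ l * (a l j k * t ^ k))"
    by (simp add: d sum_distrib_right mult.assoc)
  also have "\<dots> = (\<Sum>l\<in>UNIV. \<Sum>k. Z $ i $ l * (a l j k * t ^ k))"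
    by (rule suminf_sum) (intro summable_mult sm)
  also have "\<dots> = (Z ** mexp (t *\<^sub>R Z)) $ i $ j"
    by (simp add: matrix_matrix_mult_def e suminf_mult sm)
  finally show "((\<lambda>t. mexp (t *\<^sub>R Z) $ i $ j) has_field_derivative
      (Z ** mexp (t *\<^sub>R Z)) $ i $ j) (at t)"
    using termdiffs_strong_converges_everywhere [OF sm, of i j t] by (simp add: e)
qed

lemma bounded_bilinear_matrix_mult:
  "bounded_bilinear ((**) :: real^'n^'m \<Rightarrow> real^'k^'n \<Rightarrow> real^'k^'m)"
  unfolding bilinear_conv_bounded_bilinear [symmetric] bilinear_def
  by (auto intro!: linearI
      simp: matrix_matrix_mult_def vec_eq_iff sum.distrib sum_distrib_left algebra_simps)

lemma bounded_bilinear_matrix_vector: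
  "bounded_bilinear ((*v) :: real^'n^'m \<Rightarrow> real^'n \<Rightarrow> real^'m)"
  unfolding bilinear_conv_bounded_bilinear [symmetric] bilinear_def
  by (auto intro!: linearI
      simp: matrix_vector_mult_def vec_eq_iff sum.distrib sum_distrib_left algebra_simps)

interpretation mm: bounded_bilinear "(**) :: real^'n^'m \<Rightarrow> real^'k^'n \<Rightarrow> real^'k^'m"
  by (rule bounded_bilinear_matrix_mult)

interpretation mv: bounded_bilinear "(*v) :: real^'n^'m \<Rightarrow> real^'n \<Rightarrow> real^'m"
  by (rule bounded_bilinear_matrix_vector)

lemma mexp_0 [simp]: "mexp (0 :: real^'n^'n) = mat 1"
proof -
  have "mexp (0 *\<^sub>R (0::real^'n^'n)) $ i $ j = mat 1 $ i $ j" for i j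
    unfolding mexp_entry by (subst suminf_finite [of "{0}"]) auto
  then show ?thesis by (simp add: vec_eq_iff)
qed

text \<open>Every partial sum of the exponential series commutes with \<open>Z\<close>, and multiplication is continuous.\<close>

lemma mexp_commute: "Z ** mexp (t *\<^sub>R Z) = mexp (t *\<^sub>R Z) ** (Z :: real^'n^'n)"
proof -
  let ?P = "\<lambda>k. inverse (fact k) *\<^sub>R (((**) (t *\<^sub>R Z)) ^^ k) (mat 1)"
  have "Z ** (((**) Z) ^^ k) (mat 1) = (((**) Z) ^^ k) (mat 1) ** Z" for k
    by (induct k) (simp_all add: matrix_mul_assoc)
  then have "Z ** ?P k = ?P k ** Z" for k
    by (simp add: mat_pow_scaleR mm.scaleR_left mm.scaleR_right)
  then have "(\<lambda>k. Z ** ?P k) sums (mexp (t *\<^sub>R Z) ** Z)"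
    using bounded_linear.sums [OF mm.bounded_linear_left mexp_sums] by simp
  then show ?thesis
    using bounded_linear.sums [OF mm.bounded_linear_right mexp_sums] sums_unique2 by blast
qed

lemma mexp_has_vector_derivative_comp:
  fixes Z :: "real^'n^'n"
  assumes "(\<phi> has_real_derivative d) (at t within T)"
  shows "((\<lambda>t. mexp (\<phi> t *\<^sub>R Z)) has_vector_derivative d *\<^sub>R (Z ** mexp (\<phi> t *\<^sub>R Z))) (at t within T)"
  using vector_diff_chain_within [of \<phi> d t T "\<lambda>t. mexp (t *\<^sub>R Z)" "Z ** mexp (\<phi> t *\<^sub>R Z)"] assms
  by (auto simp: has_real_derivative_iff_has_vector_derivative o_def
      intro: has_vector_derivative_at_within mexp_has_vector_derivative)

text \<open>The product has derivative \<open>-e\<^sup>-\<^sup>t\<^sup>Z Z e\<^sup>t\<^sup>Z + e\<^sup>-\<^sup>t\<^sup>Z Z e\<^sup>t\<^sup>Z = 0\<close>, hence equals its value at \<open>t = 0\<close>.\<close>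

lemma mexp_minus_mult [simp]: "mexp (- (t *\<^sub>R Z)) ** mexp (t *\<^sub>R Z) = mat 1"
  for Z :: "real^'n^'n"
proof -
  have "((\<lambda>t. mexp ((- t) *\<^sub>R Z) ** mexp (t *\<^sub>R Z)) has_vector_derivative 0) (at t)" for t
  proof -
    have m: "((\<lambda>t. mexp ((- t) *\<^sub>R Z)) has_vector_derivative (- 1) *\<^sub>R (Z ** mexp ((- t) *\<^sub>R Z))) (at t)"
      by (rule mexp_has_vector_derivative_comp) (auto intro!: derivative_eq_intros)
    show ?thesis
      using mm.has_vector_derivative [OF m mexp_has_vector_derivative [of Z t]]
      by (simp only: mexp_commute [of Z "- t"]) (simp add: mm.minus_left matrix_mul_assoc)
  qed
  then obtain C where C: "mexp ((- t) *\<^sub>R Z) ** mexp (t *\<^sub>R Z) = C" for t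
    using has_vector_derivative_zero_constant [of UNIV "\<lambda>t. mexp ((- t) *\<^sub>R Z) ** mexp (t *\<^sub>R Z)"]
    by auto
  show ?thesis using C [of t] C [of 0] by simp
qed

text \<open>Again by differentiation: \<open>e\<^sup>-\<^sup>t\<^sup>Z e\<^bsup>(t+b)Z\<^esup>\<close> does not depend on \<open>t\<close>.\<close>

lemma mexp_add:
  fixes Z :: "real^'n^'n"
  shows "mexp (a *\<^sub>R Z) ** mexp (b *\<^sub>R Z) = mexp ((a + b) *\<^sub>R Z)"
proof -
  let ?F = "\<lambda>t. mexp ((- t) *\<^sub>R Z) ** mexp ((t + b) *\<^sub>R Z)"
  have "(?F has_vector_derivative 0) (at t)" for t
  proof -
    have m: "((\<lambda>t. mexp ((- t) *\<^sub>R Z)) has_vector_derivative (- 1) *\<^sub>R (Z ** mexp ((- t) *\<^sub>R Z))) (at t)"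
      by (rule mexp_has_vector_derivative_comp) (auto intro!: derivative_eq_intros)
    have p: "((\<lambda>t. mexp ((t + b) *\<^sub>R Z)) has_vector_derivative 1 *\<^sub>R (Z ** mexp ((t + b) *\<^sub>R Z))) (at t)"
      by (rule mexp_has_vector_derivative_comp) (auto intro!: derivative_eq_intros)
    show ?thesis
      using mm.has_vector_derivative [OF m p]
      by (simp only: mexp_commute [of Z "- t"]) (simp add: mm.minus_left matrix_mul_assoc)
  qed
  then obtain C where C: "?F t = C" for t
    using has_vector_derivative_zero_constant [of UNIV ?F] by auto
  have "mexp (a *\<^sub>R Z) ** ?F a = mexp (a *\<^sub>R Z) ** ?F 0"
    by (simp only: C)
  then show ?thesis
    using mexp_minus_mult [of "- a" Z] by (simp add: matrix_mul_assoc)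
qed

lemma matrix_inv_eqI:
  fixes B C :: "real^'n^'n"
  assumes "B ** C = mat 1"
  shows "matrix_inv B = C"
proof -
  have CB: "C ** B = mat 1"
    using assms by (rule matrix_left_right_inverse [THEN iffD1])
  have "matrix_inv B ** B = mat 1"
    using someI_ex [of "\<lambda>B'. B ** B' = mat 1 \<and> B' ** B = mat 1"] assms CB
    unfolding matrix_inv_def by blast
  then have "matrix_inv B ** B ** C = C" by simp
  then show ?thesis by (simp add: matrix_mul_assoc [symmetric] assms)
qed

section \<open>Symmetry\<close>

lemma SEI_sel [simp]:
  "nstages (SEI s c b A) = s"
  "stage_y (SEI s c b A) i Z = mexp (c i *\<^sub>R Z)"
  "stage_f (SEI s c b A) i j Z = A i j *\<^sub>R mexp ((c i - c j) *\<^sub>R Z)"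
  "update_y (SEI s c b A) Z = mexp Z"
  "update_f (SEI s c b A) i Z = b i *\<^sub>R mexp ((1 - c i) *\<^sub>R Z)"
  by (simp_all add: SEI_def exp_integrator_def)

text \<open>Since the update of the reversed scheme has the propagator \<open>e\<^sup>-\<^sup>Z\<close>, solving it for the known value
  multiplies by \<open>e\<^sup>Z\<close>, and all propagators then merge into single exponentials. What remains are the
  relations between \<open>c\<close>, \<open>b\<close>, \<open>A\<close> that define a symmetric Runge-Kutta method.\<close>

theorem SEI_symmetric:
  assumes "rk_symmetric s c b A"
  shows "ei_symmetric (SEI s c b A :: 'n::finite scheme)"
proof -
  have inv: "matrix_inv (mexp (- Z)) = mexp Z" for Z :: "real^'n^'n"
    using mexp_minus_mult [of 1 Z] by (simp add: matrix_inv_eqI)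
  have add: "mexp (a *\<^sub>R Z) ** mexp Z = mexp ((a + 1) *\<^sub>R Z)"
    "mexp Z ** mexp (a *\<^sub>R Z) = mexp ((1 + a) *\<^sub>R Z)" for a and Z :: "real^'n^'n"
    using mexp_add [of a Z 1] mexp_add [of 1 Z a] by simp_all
  have sym: "c (Suc s - i) = 1 - c i" "b (Suc s - i) = b i" if "i \<in> {Suc 0..s}" for i
    using assms that unfolding rk_symmetric_def by (auto simp: algebra_simps)
  have symA: "A (Suc s - i) (Suc s - j) = b j - A i j"
    if "i \<in> {Suc 0..s}" "j \<in> {Suc 0..s}" for i j
    using assms that sym(2) [of j] unfolding rk_symmetric_def by (auto simp: algebra_simps)
  have neg: "x *\<^sub>R - Z = (- x) *\<^sub>R Z" for x and Z :: "real^'n^'n" by simp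
  show ?thesis
    unfolding ei_symmetric_def adjoint_scheme_def renumbered_def solved_def reversed_def
    by (simp add: inv mm.minus_right mm.minus_left mm.scaleR_right mm.scaleR_left add mexp_add
         neg del: scaleR_minus_left scaleR_minus_right)
      (simp add: sym symA scaleR_diff_left)
qed

section \<open>Functions of class \<open>C\<^sup>k\<close>\<close>

lemma ck_SucI:
  assumes "\<And>x. (f has_derivative f' x) (at x)" "\<And>v. ck k (\<lambda>x. f' x v)"
  shows "ck (Suc k) f"
proof -
  have "frechet_derivative f (at x) = f' x" for x
    using frechet_derivative_at [OF assms(1)] by simp
  then show ?thesis
    using assms by (auto simp: differentiable_def)
qed

lemma ck_SucD:
  assumes "ck (Suc k) f"
  shows "(f has_derivative frechet_derivative f (at x)) (at x)"
    and "ck k (\<lambda>x. frechet_derivative f (at x) v)"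
  using assms by (auto simp: frechet_derivative_works)

lemma ck_Suc_imp_ck: "ck (Suc k) f \<Longrightarrow> ck k f"
proof (induct k arbitrary: f)
  case 0
  then show ?case
    by (auto intro!: differentiable_imp_continuous_on simp: differentiable_on_def
        intro: differentiable_at_withinI)
next
  case (Suc k)
  then show ?case by (simp del: ck.simps(1))
qed

lemma ck_antimono: "l \<le> k \<Longrightarrow> ck k f \<Longrightarrow> ck l f"
  by (induct k rule: dec_induct) (auto intro: ck_Suc_imp_ck simp del: ck.simps)

lemma ck_const: "ck k (\<lambda>x. a)"
  by (induct k arbitrary: a) (auto intro!: ck_SucI [where f' = "\<lambda>_ _. 0"] simp del: ck.simps(2))

lemma ck_linear_compose: 
  assumes "bounded_linear T" "ck k f"
  shows "ck k (\<lambda>x. T (f x))"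
  using assms(2)
proof (induct k arbitrary: f)
  case 0
  then show ?case using assms(1) by (simp add: bounded_linear.continuous_on)
next
  case (Suc k)
  show ?case
    by (rule ck_SucI [OF bounded_linear.has_derivative [OF assms(1) ck_SucD(1) [OF Suc.prems]]])
      (rule Suc.hyps [OF ck_SucD(2) [OF Suc.prems]])
qed

lemma ck_bounded_linear: 
  assumes "bounded_linear T"
  shows "ck k T"
proof (cases k)
  case 0
  then show ?thesis using linear_continuous_on [OF assms] by simp
next
  case (Suc l)
  have "ck (Suc l) T"
    by (rule ck_SucI [OF bounded_linear_imp_has_derivative [OF assms] ck_const])
  then show ?thesis by (simp only: Suc)
qed

lemma ck_add:
  assumes "ck k f" "ck k g"
  shows "ck k (\<lambda>x. f x + g x)"
  using assms
proof (induct k arbitrary: f g)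
  case 0
  then show ?case by (simp add: continuous_on_add)
next
  case (Suc k)
  show ?case
    by (rule ck_SucI [OF has_derivative_add [OF ck_SucD(1) [OF Suc.prems(1)] ck_SucD(1) [OF Suc.prems(2)]]])
      (rule Suc.hyps [OF ck_SucD(2) [OF Suc.prems(1)] ck_SucD(2) [OF Suc.prems(2)]])
qed

lemma ck_sum:
  assumes "\<And>i. i \<in> I \<Longrightarrow> ck k (f i)"
  shows "ck k (\<lambda>x. \<Sum>i\<in>I. f i x)"
  using assms by (induct I rule: infinite_finite_induct) (auto intro: ck_const ck_add)

lemma ck_bilinear:
  assumes pr: "bounded_bilinear pr" and "ck k f" "ck k g"
  shows "ck k (\<lambda>x. pr (f x) (g x))"
  using assms(2,3)
proof (induct k arbitrary: f g)
  case 0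
  then show ?case using pr by (simp add: bounded_bilinear.continuous_on)
next
  case (Suc k)
  show ?case
  proof (rule ck_SucI [OF bounded_bilinear.FDERIV [OF pr ck_SucD(1) [OF Suc.prems(1)] ck_SucD(1) [OF Suc.prems(2)]]])
    show "ck k (\<lambda>x. pr (f x) (frechet_derivative g (at x) v) + pr (frechet_derivative f (at x) v) (g x))" for v
      by (intro ck_add Suc.hyps ck_SucD(2) [OF Suc.prems(1)] ck_SucD(2) [OF Suc.prems(2)]
          ck_Suc_imp_ck [OF Suc.prems(1)] ck_Suc_imp_ck [OF Suc.prems(2)])
  qed
qed

text \<open>By the chain rule, the directional derivative of \<open>f \<circ> g\<close> is \<open>f'(g(x))(g'(x) v)\<close>. Expanding \<open>g'(x) v\<close> in
  the basis makes this a sum of products of functions to which the induction hypothesis applies;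
  in the original form the direction varies with \<open>x\<close>, which the definition of \<^const>\<open>ck\<close> does not
  cover.\<close>

lemma ck_compose:
  fixes f :: "'b::euclidean_space \<Rightarrow> 'c::real_normed_vector" and g :: "'a::euclidean_space \<Rightarrow> 'b"
  assumes "ck k f" "ck k g"
  shows "ck k (\<lambda>x. f (g x))"
  using assms
proof (induct k arbitrary: f g)
  case 0
  then show ?case
    using continuous_on_compose2 [of UNIV f UNIV g] by simp
next
  case (Suc k)
  have f: "(f has_derivative frechet_derivative f (at y)) (at y)" for y
    by (rule ck_SucD(1) [OF Suc.prems(1)])
  have lin: "frechet_derivative f (at y) u = (\<Sum>b\<in>Basis. (u \<bullet> b) *\<^sub>R frechet_derivative f (at y) b)" for y u
  proof -
    have "linear (frechet_derivative f (at y))"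
      by (rule has_derivative_linear [OF f])
    then have "frechet_derivative f (at y) (\<Sum>b\<in>Basis. (u \<bullet> b) *\<^sub>R b)
        = (\<Sum>b\<in>Basis. (u \<bullet> b) *\<^sub>R frechet_derivative f (at y) b)"
      by (simp add: linear_sum linear_cmul)
    then show ?thesis by (simp only: euclidean_representation)
  qed
  show ?case
  proof (rule ck_SucI [OF has_derivative_compose [OF ck_SucD(1) [OF Suc.prems(2)] f]])
    fix v
    have "ck k (\<lambda>x. \<Sum>b\<in>Basis. (frechet_derivative g (at x) v \<bullet> b) *\<^sub>R frechet_derivative f (at (g x)) b)"
      by (intro ck_sum ck_bilinear [OF bounded_bilinear_scaleR]
          ck_linear_compose [OF bounded_linear_inner_left] ck_SucD(2) [OF Suc.prems(2)]
          Suc.hyps [OF ck_SucD(2) [OF Suc.prems(1)] ck_Suc_imp_ck [OF Suc.prems(2)]])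
    then show "ck k (\<lambda>x. frechet_derivative f (at (g x)) (frechet_derivative g (at x) v))"
      by (subst lin)
  qed
qed

text \<open>On a compact ball the partial derivatives are bounded. The same constant bounds the derivative and
  serves as Lipschitz constant; the contraction constant of the stage equations and that of
  their linearisation thus agree.\<close>

lemma ck_1_lipschitz_on_cball:
  fixes f :: "'a::euclidean_space \<Rightarrow> 'b::real_normed_vector"
  assumes "ck (Suc 0) f"
  obtains L where "0 \<le> L"
    and "\<And>x v. x \<in> cball y0 R \<Longrightarrow> norm (frechet_derivative f (at x) v) \<le> L * norm v"
    and "\<And>x x'. \<lbrakk>x \<in> cball y0 R; x' \<in> cball y0 R\<rbrakk> \<Longrightarrow> norm (f x - f x') \<le> L * norm (x - x')"
proof -
  let ?D = "\<lambda>x. frechet_derivative f (at x)"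
  have der: "(f has_derivative ?D x) (at x)" for x
    by (rule ck_SucD(1) [OF assms])
  have "\<exists>K\<ge>0. \<forall>x\<in>cball y0 R. norm (?D x b) \<le> K" for b
  proof -
    have "continuous_on (cball y0 R) (\<lambda>x. ?D x b)"
      using ck_SucD(2) [OF assms] by (auto intro: continuous_on_subset)
    then have "bounded ((\<lambda>x. ?D x b) ` cball y0 R)"
      by (intro compact_imp_bounded compact_continuous_image) auto
    then show ?thesis
      by (metis (no_types, lifting) bounded_pos image_eqI less_imp_le)
  qed
  then obtain K where K: "0 \<le> K b" "\<And>x. x \<in> cball y0 R \<Longrightarrow> norm (?D x b) \<le> K b" for b
    by metis
  define L where "L = (\<Sum>b\<in>Basis. K b)"
  have DL: "norm (?D x v) \<le> L * norm v" if "x \<in> cball y0 R" for x v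
  proof -
    have "linear (?D x)"
      by (rule has_derivative_linear [OF der])
    then have "?D x (\<Sum>b\<in>Basis. (v \<bullet> b) *\<^sub>R b) = (\<Sum>b\<in>Basis. (v \<bullet> b) *\<^sub>R ?D x b)"
      by (simp add: linear_sum linear_cmul)
    then have "?D x v = (\<Sum>b\<in>Basis. (v \<bullet> b) *\<^sub>R ?D x b)"
      by (simp only: euclidean_representation)
    also have "norm \<dots> \<le> (\<Sum>b\<in>Basis. norm v * K b)"
      using K that by (intro sum_norm_le) (auto simp: Basis_le_norm intro!: mult_mono)
    finally show ?thesis
      by (simp add: L_def sum_distrib_left mult.commute)
  qed
  have "norm (f x - f x') \<le> L * norm (x - x')" if "x \<in> cball y0 R" "x' \<in> cball y0 R" for x x'
  proof (rule differentiable_bound [OF convex_cball [of y0 R]])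
    show "onorm (?D z) \<le> L" if "z \<in> cball y0 R" for z
      by (rule onorm_le) (rule DL [OF that])
  qed (use that in \<open>auto intro: has_derivative_at_withinI der\<close>)
  moreover have "0 \<le> L"
    using K by (auto simp: L_def intro: sum_nonneg)
  ultimately show ?thesis using that DL by blast
qed

lemma ck_mexp_line: "ck k (\<lambda>t. mexp (t *\<^sub>R Z) :: real^'n^'n)"
proof (induct k)
  case 0
  show ?case
    by (auto intro!: continuous_at_imp_continuous_on
        has_vector_derivative_continuous [OF mexp_has_vector_derivative])
next
  case (Suc k)
  show ?case
  proof (rule ck_SucI)
    show "((\<lambda>t. mexp (t *\<^sub>R Z)) has_derivative (\<lambda>v. v *\<^sub>R (Z ** mexp (x *\<^sub>R Z)))) (at x)" for x
      using mexp_has_vector_derivative [of Z x] by (simp add: has_vector_derivative_def)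
    show "ck k (\<lambda>x. v *\<^sub>R (Z ** mexp (x *\<^sub>R Z)))" for v
      by (intro ck_linear_compose [OF bounded_linear_scaleR_right]
          ck_linear_compose [OF mm.bounded_linear_right] Suc)
  qed
qed

section \<open>Existence and differentiability of implicit stages\<close>

text \<open>The step hypothesis for the maximum of the family bounds the maximum by itself times \<open>q < 1\<close>.\<close>

lemma sup_estimate:
  fixes e :: "'i \<Rightarrow> real"
  assumes "finite I" "q < 1"
    and step: "\<And>d i. \<lbrakk>\<forall>j\<in>I. e j \<le> d; i \<in> I\<rbrakk> \<Longrightarrow> e i \<le> q * d + \<delta>"
    and "i \<in> I"
  shows "e i \<le> \<delta> / (1 - q)"
proof -
  define d where "d = Max (e ` I)"
  have le: "\<forall>j\<in>I. e j \<le> d"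
    using \<open>finite I\<close> by (simp add: d_def)
  have "d \<in> e ` I"
    unfolding d_def using \<open>finite I\<close> \<open>i \<in> I\<close> by (intro Max_in) auto
  then obtain k where "k \<in> I" "d = e k" by blast
  then have "d \<le> q * d + \<delta>"
    using step [OF le, of k] by simp
  then have "d \<le> \<delta> / (1 - q)"
    using \<open>q < 1\<close> by (simp add: field_simps)
  with le \<open>i \<in> I\<close> show ?thesis by (blast intro: order_trans)
qed

text \<open>Banach's fixed point theorem for the maximum norm on finite families. Quantifying over a common
  bound \<open>d\<close> replaces that norm, so no metric space of families has to be built. The
  map sends families in \<open>S\<close> to families in a closed subset \<open>T\<close>; this permits an open \<open>S\<close>.\<close>

lemma contraction_family_fixpoint:
  fixes \<Phi> :: "('i \<Rightarrow> 'a::banach) \<Rightarrow> 'i \<Rightarrow> 'a"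
  assumes fin: "finite I" and T: "closed T" "T \<subseteq> S" and x0: "x0 \<in> S"
    and q: "0 \<le> q" "q < 1"
    and maps: "\<And>W i. \<lbrakk>\<forall>j\<in>I. W j \<in> S; i \<in> I\<rbrakk> \<Longrightarrow> \<Phi> W i \<in> T"
    and contr: "\<And>W W' d i. \<lbrakk>\<forall>j\<in>I. W j \<in> S; \<forall>j\<in>I. W' j \<in> S;
        \<forall>j\<in>I. norm (W j - W' j) \<le> d; i \<in> I\<rbrakk> \<Longrightarrow> norm (\<Phi> W i - \<Phi> W' i) \<le> q * d"
  shows "\<exists>!W. W \<in> I \<rightarrow>\<^sub>E S \<and> (\<forall>i\<in>I. W i = \<Phi> W i)"
proof (rule ex_ex1I)
  define W where "W n = (\<Phi> ^^ n) (\<lambda>_. x0)" for n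
  have WS: "W n i \<in> S" if "i \<in> I" for n i
    using that
  proof (induct n arbitrary: i)
    case 0
    show ?case by (simp add: W_def x0)
  next
    case (Suc n)
    then have "\<Phi> (W n) i \<in> T" by (intro maps) auto
    then show ?case using T by (auto simp: W_def)
  qed
  define d0 where "d0 = (\<Sum>j\<in>I. norm (W 1 j - W 0 j))"
  have geo: "\<forall>i\<in>I. norm (W (Suc n) i - W n i) \<le> q ^ n * d0" for n
  proof (induct n)
    case 0
    show ?case
      by (auto simp: d0_def intro!: member_le_sum fin)
  next
    case (Suc n)
    have "norm (\<Phi> (W (Suc n)) i - \<Phi> (W n) i) \<le> q * (q ^ n * d0)" if "i \<in> I" for i
      using that by (intro contr Suc) (auto intro: WS)
    then show ?case by (simp add: W_def mult.assoc)
  qed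
  have "convergent (\<lambda>n. W n i)" if "i \<in> I" for i
  proof -
    have "summable (\<lambda>n. W (Suc n) i - W n i)"
    proof (rule summable_comparison_test')
      show "summable (\<lambda>n. q ^ n * d0)"
        using q by (intro summable_mult2 summable_geometric) simp
      show "norm (W (Suc n) i - W n i) \<le> q ^ n * d0" for n
        using geo that by blast
    qed
    then have "convergent (\<lambda>n. W n i - W 0 i)"
      by (simp add: summable_iff_convergent sum_lessThan_telescope [of "\<lambda>n. W n i"])
    then have "convergent (\<lambda>n. (W n i - W 0 i) + W 0 i)"
      by (intro convergent_add convergent_const)
    then show ?thesis by simp
  qed
  then obtain Y where Y: "(\<lambda>n. W n i) \<longlonglongrightarrow> Y i" if "i \<in> I" for i
    unfolding convergent_def by metis
  have YS: "Y i \<in> S" if "i \<in> I" for i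
  proof -
    have "W (Suc n) i \<in> T" for n
      using maps [of "W n" i] WS that by (simp add: W_def)
    then have "Y i \<in> T"
      by (rule closed_sequentially [OF \<open>closed T\<close>]) (rule LIMSEQ_Suc [OF Y [OF that]])
    then show ?thesis using T by blast
  qed
  have fixp: "Y i = \<Phi> (restrict Y I) i" if i: "i \<in> I" for i
  proof (rule LIMSEQ_unique)
    show "(\<lambda>n. W (Suc n) i) \<longlonglongrightarrow> Y i"
      by (rule LIMSEQ_Suc [OF Y [OF i]])
    show "(\<lambda>n. W (Suc n) i) \<longlonglongrightarrow> \<Phi> (restrict Y I) i"
    proof (rule LIM_zero_cancel, rule Lim_null_comparison)
      show "(\<lambda>n. q * (\<Sum>j\<in>I. norm (W n j - Y j))) \<longlonglongrightarrow> 0"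
        by (intro tendsto_mult_right_zero tendsto_null_sum tendsto_norm_zero LIM_zero Y)
      have "norm (\<Phi> (W n) i - \<Phi> (restrict Y I) i) \<le> q * (\<Sum>j\<in>I. norm (W n j - Y j))" for n
        using i by (intro contr)
          (auto intro: WS YS intro!: member_le_sum fin)
      then show "\<forall>\<^sub>F n in sequentially. norm (W (Suc n) i - \<Phi> (restrict Y I) i)
          \<le> q * (\<Sum>j\<in>I. norm (W n j - Y j))"
        by (simp add: W_def)
    qed
  qed
  show "\<exists>W. W \<in> I \<rightarrow>\<^sub>E S \<and> (\<forall>i\<in>I. W i = \<Phi> W i)"
    using YS by (intro exI [of _ "restrict Y I"]) (auto simp: fixp [symmetric])
next
  fix W W' assume W: "W \<in> I \<rightarrow>\<^sub>E S \<and> (\<forall>i\<in>I. W i = \<Phi> W i)" and W': "W' \<in> I \<rightarrow>\<^sub>E S \<and> (\<forall>i\<in>I. W' i = \<Phi> W' i)"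
  have "norm (W i - W' i) \<le> 0 / (1 - q)" if "i \<in> I" for i
  proof (rule sup_estimate [OF fin \<open>q < 1\<close> _ that])
    fix d i assume *: "\<forall>j\<in>I. norm (W j - W' j) \<le> d" "i \<in> I"
    then have "norm (\<Phi> W i - \<Phi> W' i) \<le> q * d"
      using W W' by (intro contr) blast+
    moreover have "W i = \<Phi> W i" "W' i = \<Phi> W' i"
      using W W' \<open>i \<in> I\<close> by blast+
    ultimately show "norm (W i - W' i) \<le> q * d + 0"
      by simp
  qed
  then have eq: "W i = W' i" if "i \<in> I" for i
    using that by simp
  show "W = W'"
    by (rule PiE_ext [of W I "\<lambda>_. S" W']) (use W W' eq in blast)+
qed

lemma has_derivative_iff_eventually:
  "(f has_derivative f') (at x) \<longleftrightarrow> bounded_linear f' \<and>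
    (\<forall>e>0. \<forall>\<^sub>F y in nhds x. norm (f y - f x - f' (y - x)) \<le> e * norm (y - x))"
  by (simp add: has_derivative_at_alt eventually_nhds_metric dist_norm)

text \<open>The equations \<open>Y\<^sub>i = P\<^sub>i y + \<Sum>\<^sub>j T\<^sub>i\<^sub>j f(Y\<^sub>j)\<close> with initial values \<open>y\<close> near \<open>y\<^sub>0\<close>. In a one-step method \<open>P\<^sub>i\<close> is
  close to the identity and \<open>T\<^sub>i\<^sub>j = O(h)\<close>; the last three assumptions say how small \<open>h\<close> has to be. The
  stages are sought in the ball of radius \<open>R/2\<close> around \<open>y\<close>, which lies in \<open>cball y\<^sub>0 R\<close> for all \<open>y\<close> in
  \<open>ball y\<^sub>0 (R/2)\<close>. The bounds \<open>R/8\<close> keep the right-hand sides within \<open>R/4\<close> of \<open>y\<close>, the bound \<open>1/2\<close>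
  makes them contractive.\<close>

locale stage_system =
  fixes I :: "'i set" and P :: "'i \<Rightarrow> 'a::banach \<Rightarrow>\<^sub>L 'a" and T :: "'i \<Rightarrow> 'i \<Rightarrow> 'a \<Rightarrow>\<^sub>L 'a"
    and f :: "'a \<Rightarrow> 'a" and y0 :: 'a and R L B :: real
  assumes fin: "finite I" and R: "0 < R" and L: "0 \<le> L"
    and lip: "\<And>x x'. \<lbrakk>x \<in> cball y0 R; x' \<in> cball y0 R\<rbrakk> \<Longrightarrow> norm (f x - f x') \<le> L * norm (x - x')"
    and bound: "\<And>x. x \<in> cball y0 R \<Longrightarrow> norm (f x) \<le> B"
    and P_near: "\<And>i. i \<in> I \<Longrightarrow> norm (P i - id_blinfun) * (norm y0 + R) \<le> R / 8"
    and T_small: "\<And>i. i \<in> I \<Longrightarrow> (\<Sum>j\<in>I. norm (T i j)) * B \<le> R / 8"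
    and T_contr: "\<And>i. i \<in> I \<Longrightarrow> (\<Sum>j\<in>I. norm (T i j)) * L \<le> 1 / 2"
begin

definition is_stages :: "'a \<Rightarrow> ('i \<Rightarrow> 'a) \<Rightarrow> bool" where
  "is_stages y Y \<longleftrightarrow> Y \<in> I \<rightarrow>\<^sub>E ball y (R / 2) \<and> (\<forall>i\<in>I. Y i = P i y + (\<Sum>j\<in>I. T i j (f (Y j))))"

definition stages :: "'a \<Rightarrow> 'i \<Rightarrow> 'a" where
  "stages y = (THE Y. is_stages y Y)"

lemma T_sum_bound:
  assumes "i \<in> I" "\<forall>j\<in>I. norm (u j) \<le> K"
  shows "norm (\<Sum>j\<in>I. T i j (u j)) \<le> (\<Sum>j\<in>I. norm (T i j)) * K"
  unfolding sum_distrib_right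
  using assms by (intro sum_norm_le order_trans [OF norm_blinfun] mult_left_mono) auto

text \<open>The form in which the contraction property is used, both for differences of stages and for the
  linearised equations.\<close>

lemma T_sum_contr:
  assumes "i \<in> I" "\<forall>j\<in>I. norm (u j) \<le> L * d" "0 \<le> d"
  shows "norm (\<Sum>j\<in>I. T i j (u j)) \<le> 1 / 2 * d"
  using T_sum_bound [OF assms(1,2)] mult_right_mono [OF T_contr [OF \<open>i \<in> I\<close>] \<open>0 \<le> d\<close>]
  by (simp add: mult.assoc)

lemma ball_sub: "y \<in> ball y0 (R / 2) \<Longrightarrow> x \<in> ball y (R / 2) \<Longrightarrow> x \<in> ball y0 R"
  using dist_triangle [of y0 x y] by simp

lemma ex1_stages:
  assumes y: "y \<in> ball y0 (R / 2)"
  shows "\<exists>!Y. is_stages y Y"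
  unfolding is_stages_def
proof (rule contraction_family_fixpoint [where T = "cball y (R / 4)" and q = "1 / 2" and ?x0.0 = y])
  note sub = ball_sub [OF y]
  have ny: "norm y \<le> norm y0 + R"
    using y R norm_triangle_ineq2 [of y y0] by (simp add: dist_norm norm_minus_commute)
  show "P i y + (\<Sum>j\<in>I. T i j (f (W j))) \<in> cball y (R / 4)"
    if W: "\<forall>j\<in>I. W j \<in> ball y (R / 2)" and i: "i \<in> I" for W i
  proof -
    have "norm (P i y - y) \<le> norm (P i - id_blinfun) * norm y"
      using norm_blinfun [of "P i - id_blinfun" y] by (simp add: blinfun.diff_left)
    also have "\<dots> \<le> norm (P i - id_blinfun) * (norm y0 + R)"
      by (intro mult_left_mono ny) simp
    also have "\<dots> \<le> R / 8" by (rule P_near [OF i])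
    finally have 1: "norm (P i y - y) \<le> R / 8" .
    have "norm (f (W j)) \<le> B" if "j \<in> I" for j
      using sub [of "W j"] W that by (intro bound) simp
    then have "norm (\<Sum>j\<in>I. T i j (f (W j))) \<le> R / 8"
      using T_sum_bound [OF i, of "\<lambda>j. f (W j)" B] T_small [OF i] by simp
    then show ?thesis
      using 1 norm_triangle_ineq [of "P i y - y" "\<Sum>j\<in>I. T i j (f (W j))"]
      by (simp add: dist_norm norm_minus_commute algebra_simps)
  qed
  show "norm (P i y + (\<Sum>j\<in>I. T i j (f (W j))) - (P i y + (\<Sum>j\<in>I. T i j (f (W' j))))) \<le> 1 / 2 * d"
    if W: "\<forall>j\<in>I. W j \<in> ball y (R / 2)" "\<forall>j\<in>I. W' j \<in> ball y (R / 2)"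
      and d: "\<forall>j\<in>I. norm (W j - W' j) \<le> d" and i: "i \<in> I" for W W' d i
  proof -
    have "0 \<le> d" using d i norm_ge_zero order_trans by blast
    have "norm (f (W j) - f (W' j)) \<le> L * d" if "j \<in> I" for j
    proof -
      have "norm (f (W j) - f (W' j)) \<le> L * norm (W j - W' j)"
        using sub [of "W j"] sub [of "W' j"] W that by (intro lip) auto
      also have "\<dots> \<le> L * d"
        using d that L by (intro mult_left_mono) auto
      finally show ?thesis .
    qed
    then have "norm (\<Sum>j\<in>I. T i j (f (W j) - f (W' j))) \<le> 1 / 2 * d"
      using i \<open>0 \<le> d\<close> by (intro T_sum_contr) auto
    then show ?thesis
      by (simp add: blinfun.diff_right sum_subtractf)
  qed
qed (use fin R in auto)

lemma is_stages_stages: "y \<in> ball y0 (R / 2) \<Longrightarrow> is_stages y (stages y)"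
  unfolding stages_def by (rule theI' [OF ex1_stages])

lemma stages_eq:
  assumes "y \<in> ball y0 (R / 2)" "i \<in> I"
  shows "stages y i = P i y + (\<Sum>j\<in>I. T i j (f (stages y j)))"
  using is_stages_stages [OF assms(1)] assms(2) unfolding is_stages_def by blast

lemma stages_in:
  assumes "y \<in> ball y0 (R / 2)" "i \<in> I"
  shows "stages y i \<in> ball y0 R"
  using is_stages_stages [OF assms(1)] assms(2) ball_sub [OF assms(1)] unfolding is_stages_def
  by blast

lemma y0_in: "y0 \<in> ball y0 (R / 2)"
  using R by simp

lemma stages_lipschitz:
  assumes y: "y \<in> ball y0 (R / 2)" and i: "i \<in> I"
  shows "norm (stages y i - stages y0 i) \<le> 2 * (\<Sum>i\<in>I. norm (P i)) * norm (y - y0)"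
proof -
  let ?C = "\<Sum>i\<in>I. norm (P i)"
  have "norm (stages y i - stages y0 i) \<le> (?C * norm (y - y0)) / (1 - 1 / 2)"
  proof (rule sup_estimate [OF fin _ _ i])
    fix d i assume d: "\<forall>j\<in>I. norm (stages y j - stages y0 j) \<le> d" and i: "i \<in> I"
    have "0 \<le> d" using d i norm_ge_zero order_trans by blast
    have "norm (f (stages y j) - f (stages y0 j)) \<le> L * d" if "j \<in> I" for j
    proof -
      have "norm (f (stages y j) - f (stages y0 j)) \<le> L * norm (stages y j - stages y0 j)"
        using stages_in [OF y that] stages_in [OF y0_in that] by (intro lip) auto
      also have "\<dots> \<le> L * d"
        using d that L by (intro mult_left_mono) auto
      finally show ?thesis .
    qed
    then have 1: "norm (\<Sum>j\<in>I. T i j (f (stages y j) - f (stages y0 j))) \<le> 1 / 2 * d"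
      using i \<open>0 \<le> d\<close> by (intro T_sum_contr) auto
    have "norm (P i (y - y0)) \<le> norm (P i) * norm (y - y0)"
      by (rule norm_blinfun)
    also have "\<dots> \<le> ?C * norm (y - y0)"
      using i fin by (intro mult_right_mono member_le_sum) auto
    finally have 2: "norm (P i (y - y0)) \<le> ?C * norm (y - y0)" .
    have "stages y i - stages y0 i
        = P i (y - y0) + (\<Sum>j\<in>I. T i j (f (stages y j) - f (stages y0 j)))"
      by (subst stages_eq [OF y i], subst stages_eq [OF y0_in i])
        (simp add: blinfun.diff_right sum_subtractf)
    then show "norm (stages y i - stages y0 i) \<le> 1 / 2 * d + ?C * norm (y - y0)"
      using 1 2 norm_triangle_ineq [of "P i (y - y0)"] by (smt (verit))
  qed simp
  then show ?thesis by (simp add: field_simps)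
qed

lemma stages_tendsto:
  assumes "i \<in> I"
  shows "((\<lambda>y. stages y i) \<longlongrightarrow> stages y0 i) (nhds y0)"
proof (rule LIM_zero_cancel, rule Lim_null_comparison)
  have "\<forall>\<^sub>F y in nhds y0. y \<in> ball y0 (R / 2)"
    using y0_in by (intro eventually_nhds_in_open) auto
  then show "\<forall>\<^sub>F y in nhds y0. norm (stages y i - stages y0 i)
      \<le> 2 * (\<Sum>i\<in>I. norm (P i)) * norm (y - y0)"
    by eventually_elim (rule stages_lipschitz [OF _ assms])
  show "((\<lambda>y. 2 * (\<Sum>i\<in>I. norm (P i)) * norm (y - y0)) \<longlongrightarrow> 0) (nhds y0)"
    by (intro tendsto_mult_right_zero tendsto_norm_zero LIM_zero filterlim_ident)
qed

text \<open>The candidate derivative is the solution of the linearised equations, which exists by the same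
  contraction principle, now in the Banach space of bounded operators. The error
  \<open>Y\<^sub>i(y) - Y\<^sub>i(y\<^sub>0) - D\<^sub>i(y - y\<^sub>0)\<close> solves the homogeneous linearised equations up to the remainders of \<open>f\<close> at the stages.
  These are \<open>o(|y - y\<^sub>0|)\<close> because the stages are Lipschitz in \<open>y\<close>, so the error is so, too.\<close>

lemma stages_has_derivative:
  assumes F: "\<And>i. i \<in> I \<Longrightarrow> (f has_derivative blinfun_apply (F i)) (at (stages y0 i))"
    and FL: "\<And>i. i \<in> I \<Longrightarrow> norm (F i) \<le> L"
  obtains D where "\<And>i. i \<in> I \<Longrightarrow> D i = P i + (\<Sum>j\<in>I. T i j o\<^sub>L (F j o\<^sub>L D j))"
    and "\<And>i. i \<in> I \<Longrightarrow> ((\<lambda>y. stages y i) has_derivative blinfun_apply (D i)) (at y0)"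
proof -
  have "\<exists>!D. D \<in> I \<rightarrow>\<^sub>E UNIV \<and> (\<forall>i\<in>I. D i = P i + (\<Sum>j\<in>I. T i j o\<^sub>L (F j o\<^sub>L D j)))"
  proof (rule contraction_family_fixpoint [where T = UNIV and q = "1 / 2" and ?x0.0 = 0])
    fix W W' :: "'i \<Rightarrow> 'a \<Rightarrow>\<^sub>L 'a" and d i
    assume d: "\<forall>j\<in>I. norm (W j - W' j) \<le> d" and i: "i \<in> I"
    have "0 \<le> d" using d i norm_ge_zero order_trans by blast
    have "norm (\<Sum>j\<in>I. T i j o\<^sub>L (F j o\<^sub>L (W j - W' j))) \<le> (\<Sum>j\<in>I. norm (T i j) * (L * d))"
      using d FL L by (intro sum_norm_le order_trans [OF norm_blinfun_compose] mult_mono) auto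
    also have "\<dots> \<le> 1 / 2 * d"
      using mult_right_mono [OF T_contr [OF i] \<open>0 \<le> d\<close>]
      by (simp add: sum_distrib_right [symmetric] mult.assoc)
    finally show "norm (P i + (\<Sum>j\<in>I. T i j o\<^sub>L (F j o\<^sub>L W j))
        - (P i + (\<Sum>j\<in>I. T i j o\<^sub>L (F j o\<^sub>L W' j)))) \<le> 1 / 2 * d"
      by (simp add: sum_subtractf [symmetric]
          bounded_bilinear.diff_right [OF bounded_bilinear_blinfun_compose])
  qed (use fin in auto)
  then obtain D where D: "D i = P i + (\<Sum>j\<in>I. T i j o\<^sub>L (F j o\<^sub>L D j))" if "i \<in> I" for i
    by blast
  have "((\<lambda>y. stages y i) has_derivative blinfun_apply (D i)) (at y0)" if i: "i \<in> I" for i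
    unfolding has_derivative_iff_eventually
  proof (intro conjI allI impI)
    fix e :: real assume e: "0 < e"
    define C \<tau> where "C = (\<Sum>i\<in>I. norm (P i))" and "\<tau> = (\<Sum>i\<in>I. \<Sum>j\<in>I. norm (T i j))"
    have C: "0 \<le> C" "0 \<le> \<tau>" by (auto simp: C_def \<tau>_def intro!: sum_nonneg)
    \<comment> \<open>The factor 4 comes from the Lipschitz constant \<open>2 C\<close> and the contraction constant \<open>1/2\<close>; the
      summand 1 guards against a vanishing denominator.\<close>
    define e' where "e' = e / (4 * \<tau> * C + 1)"
    have e': "0 < e'" "4 * \<tau> * C * e' \<le> e"
      using e C by (auto simp: e'_def field_simps add_pos_nonneg intro!: divide_pos_pos add_nonneg_pos)
    let ?rest = "\<lambda>y j. f (stages y j) - f (stages y0 j) - F j (stages y j - stages y0 j)"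
    have "\<forall>\<^sub>F y in nhds y0. norm (?rest y j) \<le> e' * norm (stages y j - stages y0 j)" if "j \<in> I" for j
      using F [OF that] \<open>0 < e'\<close> unfolding has_derivative_iff_eventually
      by (intro eventually_compose_filterlim [OF _ stages_tendsto [OF that]]) blast
    then have "\<forall>\<^sub>F y in nhds y0. \<forall>j\<in>I. norm (?rest y j) \<le> e' * norm (stages y j - stages y0 j)"
      using fin by (intro eventually_ball_finite) auto
    moreover have "\<forall>\<^sub>F y in nhds y0. y \<in> ball y0 (R / 2)"
      using y0_in by (intro eventually_nhds_in_open) auto
    ultimately show "\<forall>\<^sub>F y in nhds y0. norm (stages y i - stages y0 i - D i (y - y0)) \<le> e * norm (y - y0)"
    proof eventually_elim
      case (elim y)
      define E where "E j = stages y j - stages y0 j - D j (y - y0)" for j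
      define \<delta> where "\<delta> = \<tau> * (e' * (2 * C * norm (y - y0)))"
      have "norm (E i) \<le> \<delta> / (1 - 1 / 2)"
      proof (rule sup_estimate [OF fin _ _ i])
        fix d i assume d: "\<forall>j\<in>I. norm (E j) \<le> d" and i: "i \<in> I"
        have "0 \<le> d" using d i norm_ge_zero order_trans by blast
        have "norm (F j (E j)) \<le> L * d" if "j \<in> I" for j
          using d FL L that by (intro order_trans [OF norm_blinfun] mult_mono) auto
        then have 1: "norm (\<Sum>j\<in>I. T i j (F j (E j))) \<le> 1 / 2 * d"
          using i \<open>0 \<le> d\<close> by (intro T_sum_contr) auto
        have "norm (?rest y j) \<le> e' * (2 * C * norm (y - y0))" if "j \<in> I" for j
          using elim(1) that stages_lipschitz [OF elim(2) that] e'(1) unfolding C_def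
          by (meson mult_left_mono order_trans less_imp_le)
        then have "norm (\<Sum>j\<in>I. T i j (?rest y j)) \<le> (\<Sum>j\<in>I. norm (T i j)) * (e' * (2 * C * norm (y - y0)))"
          by (intro T_sum_bound i) auto
        also have "\<dots> \<le> \<delta>"
          unfolding \<delta>_def \<tau>_def using e' C i fin
          by (intro mult_right_mono member_le_sum [of i I "\<lambda>i. \<Sum>j\<in>I. norm (T i j)"])
            (auto intro: sum_nonneg)
        finally have 2: "norm (\<Sum>j\<in>I. T i j (?rest y j)) \<le> \<delta>" .
        \<comment> \<open>The error solves the linearised equations with the remainders of \<open>f\<close> as inhomogeneity.\<close>
        have "E i = (\<Sum>j\<in>I. T i j (F j (E j))) + (\<Sum>j\<in>I. T i j (?rest y j))"
          unfolding E_def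
          by (subst D [OF i], subst stages_eq [OF elim(2) i], subst stages_eq [OF y0_in i])
            (simp add: blinfun.diff_right blinfun.add_left blinfun.sum_left sum_subtractf)
        then show "norm (E i) \<le> 1 / 2 * d + \<delta>"
          using 1 2 norm_triangle_ineq [of "\<Sum>j\<in>I. T i j (F j (E j))"] by (smt (verit))
      qed simp
      also have "\<dots> = (4 * \<tau> * C * e') * norm (y - y0)"
        by (simp add: \<delta>_def)
      also have "\<dots> \<le> e * norm (y - y0)"
        by (intro mult_right_mono e') simp
      finally show ?case by (simp add: E_def)
    qed
  qed (rule blinfun.bounded_linear_right)
  with D show ?thesis by (rule that)
qed

end

section \<open>The stages of the exponential integrator\<close>

text \<open>The operator norm, rather than a norm of matrices, is what the smallness assumptions of the
  stage equations refer to.\<close>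

definition matrix_blinfun :: "real^'n^'m \<Rightarrow> (real^'n) \<Rightarrow>\<^sub>L (real^'m)" where
  "matrix_blinfun B = Blinfun ((*v) B)"

lemma matrix_blinfun_apply [simp]: "blinfun_apply (matrix_blinfun B) = (*v) B"
  by (simp add: matrix_blinfun_def bounded_linear_Blinfun_apply mv.bounded_linear_right)

lemma bounded_linear_matrix_blinfun: "bounded_linear matrix_blinfun"
  unfolding linear_conv_bounded_linear [symmetric]
  by (rule linearI; rule blinfun_eqI)
    (simp_all add: blinfun.add_left blinfun.scaleR_left mv.add_left mv.scaleR_left)

lemma isCont_mexp_line: "isCont (\<lambda>t. mexp (t *\<^sub>R Z)) t"
  by (rule has_vector_derivative_continuous [OF mexp_has_vector_derivative])

lemma tendsto_mexp_at_0: "((\<lambda>h. mexp (a *\<^sub>R h *\<^sub>R M)) \<longlongrightarrow> mat 1) (at 0)"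
proof -
  have "((\<lambda>h. mexp ((a * h) *\<^sub>R M)) \<longlongrightarrow> mexp (0 *\<^sub>R M)) (at 0)"
    by (intro isCont_tendsto_compose [OF isCont_mexp_line] tendsto_mult_right_zero) simp
  then show ?thesis by simp
qed

text \<open>As \<open>h \<rightarrow> 0\<close>, the propagators tend to the identity and the coefficients of \<open>f\<close> to zero, for either
  sign of \<open>h\<close>.\<close>

lemma SEI_stage_system:
  fixes M :: "real^'n^'n" and f :: "real^'n \<Rightarrow> real^'n" and s :: nat
  assumes R: "0 < R" and L: "0 \<le> L"
    and lip: "\<And>x x'. \<lbrakk>x \<in> cball y0 R; x' \<in> cball y0 R\<rbrakk> \<Longrightarrow> norm (f x - f x') \<le> L * norm (x - x')"
  shows "\<forall>\<^sub>F h in at 0. stage_system {1..s} (\<lambda>i. matrix_blinfun (mexp (c i *\<^sub>R h *\<^sub>R M)))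
      (\<lambda>i j. h *\<^sub>R A i j *\<^sub>R matrix_blinfun (mexp ((c i - c j) *\<^sub>R h *\<^sub>R M))) f y0 R L (norm (f y0) + L * R)"
proof -
  let ?P = "\<lambda>h i. matrix_blinfun (mexp (c i *\<^sub>R h *\<^sub>R M))"
  let ?T = "\<lambda>h i j. h *\<^sub>R A i j *\<^sub>R matrix_blinfun (mexp ((c i - c j) *\<^sub>R h *\<^sub>R M))"
  have mb1: "matrix_blinfun (mat 1 :: real^'n^'n) = id_blinfun"
    by (rule blinfun_eqI) simp
  have E: "((\<lambda>h. matrix_blinfun (mexp (a *\<^sub>R h *\<^sub>R M))) \<longlongrightarrow> id_blinfun) (at 0)" for a
    using bounded_linear.tendsto [OF bounded_linear_matrix_blinfun tendsto_mexp_at_0 [of a M]]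
    by (simp only: mb1)
  have P0: "((\<lambda>h. norm (?P h i - id_blinfun) * (norm y0 + R)) \<longlongrightarrow> 0) (at 0)" for i
    by (intro tendsto_mult_left_zero tendsto_norm_zero LIM_zero E)
  have T0: "((\<lambda>h. (\<Sum>j\<in>{1..s}. norm (?T h i j)) * K) \<longlongrightarrow> 0) (at 0)" for i K
  proof (intro tendsto_mult_left_zero tendsto_null_sum tendsto_norm_zero)
    fix j
    have "((\<lambda>h. ?T h i j) \<longlongrightarrow> 0 *\<^sub>R A i j *\<^sub>R id_blinfun) (at 0)"
      by (intro tendsto_intros E)
    then show "((\<lambda>h. ?T h i j) \<longlongrightarrow> 0) (at 0)" by simp
  qed
  have le: "\<forall>\<^sub>F h in at (0::real). g h \<le> e" if "(g \<longlongrightarrow> 0) (at 0)" "0 < e" for g :: "real \<Rightarrow> real" and e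
    using order_tendstoD(2) [OF that] by eventually_elim simp
  have small: "\<forall>\<^sub>F h in at 0. \<forall>i\<in>{1..s}. norm (?P h i - id_blinfun) * (norm y0 + R) \<le> R / 8
     \<and> (\<Sum>j\<in>{1..s}. norm (?T h i j)) * (norm (f y0) + L * R) \<le> R / 8
     \<and> (\<Sum>j\<in>{1..s}. norm (?T h i j)) * L \<le> 1 / 2"
    using R by (intro eventually_ball_finite ballI eventually_conj le [OF P0] le [OF T0]) auto
  have bnd: "norm (f x) \<le> norm (f y0) + L * R" if "x \<in> cball y0 R" for x
  proof -
    have "norm (f x - f y0) \<le> L * norm (x - y0)"
      using that R by (intro lip) auto
    also have "\<dots> \<le> L * R"
      using that L by (intro mult_left_mono) (auto simp: dist_norm norm_minus_commute)
    finally show ?thesis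
      using norm_triangle_ineq2 [of "f x" "f y0"] by linarith
  qed
  from small show ?thesis
    by eventually_elim (unfold_locales; use R L lip bnd in simp)
qed

lemma SEI_is_stages_iff:
  assumes "stage_system {1..s} (\<lambda>i. matrix_blinfun (mexp (c i *\<^sub>R h *\<^sub>R M)))
      (\<lambda>i j. h *\<^sub>R A i j *\<^sub>R matrix_blinfun (mexp ((c i - c j) *\<^sub>R h *\<^sub>R M))) f y0 R L B"
  shows "stage_system.is_stages {1..s} (\<lambda>i. matrix_blinfun (mexp (c i *\<^sub>R h *\<^sub>R M)))
      (\<lambda>i j. h *\<^sub>R A i j *\<^sub>R matrix_blinfun (mexp ((c i - c j) *\<^sub>R h *\<^sub>R M))) f R y Y
    \<longleftrightarrow> ei_stages (SEI s c b A) M f (R / 2) h y Y"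
  unfolding stage_system.is_stages_def [OF assms] ei_stages_def stage_eqs_def
  by (simp add: blinfun.scaleR_left scaleR_sum_right mv.scaleR_left)

section \<open>Symmetry of the Hessian\<close>

text \<open>The second difference of \<open>U\<close> over the parallelogram spanned by \<open>tv\<close> and \<open>tw\<close> is, by the mean value
  theorem along \<open>v\<close>, \<open>t\<close> times \<open>v\<close> against a first difference of the gradient in direction \<open>tw\<close>.
  Differentiability of the gradient at \<open>y\<close> evaluates the latter.\<close>

lemma second_difference_estimate:
  fixes U :: "'a::real_inner \<Rightarrow> real"
  assumes U: "\<And>x. (U has_derivative (\<lambda>h. h \<bullet> g x)) (at x)"
    and g: "(g has_derivative G) (at y)" and "0 < e"
  shows "\<exists>d>0. \<forall>t. 0 < t \<and> t < d \<longrightarrow>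
    \<bar>U (y + t *\<^sub>R v + t *\<^sub>R w) - U (y + t *\<^sub>R v) - U (y + t *\<^sub>R w) + U y - t\<^sup>2 * (v \<bullet> G w)\<bar> \<le> e * t\<^sup>2"
proof -
  define N where "N = norm v + norm w + 1"
  have N: "0 < N" "norm v \<le> N" "norm w \<le> N" by (auto simp: N_def add_nonneg_pos)
  \<comment> \<open>The two first-order remainders contribute \<open>2 e' t N\<close> and \<open>e' t N\<close>, and pairing with \<open>t v\<close> another \<open>t N\<close>.\<close>
  define e' where "e' = e / (3 * N * N)"
  have e': "0 < e'" "3 * e' * N * N = e"
    using N \<open>0 < e\<close> by (auto simp: e'_def)
  have G: "bounded_linear G" by (rule has_derivative_bounded_linear [OF g])
  obtain d where d: "0 < d" and gd: "\<And>x. norm (x - y) < d \<Longrightarrow> norm (g x - g y - G (x - y)) \<le> e' * norm (x - y)"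
    using g e' unfolding has_derivative_at_alt by blast
  show ?thesis
  proof (intro exI [of _ "d / (2 * N)"] conjI allI impI)
    show "0 < d / (2 * N)" using d N by simp
    fix t assume t: "0 < t \<and> t < d / (2 * N)"
    then have tN: "2 * (t * N) < d" using N by (simp add: field_simps)
    let ?\<psi> = "\<lambda>s. U (y + s *\<^sub>R v + t *\<^sub>R w) - U (y + s *\<^sub>R v)"
    have "\<exists>\<xi>>0. \<xi> < t \<and> ?\<psi> t - ?\<psi> 0 = (t - 0) * (v \<bullet> (g (y + \<xi> *\<^sub>R v + t *\<^sub>R w) - g (y + \<xi> *\<^sub>R v)))"
    proof (rule MVT2)
      fix s assume "0 \<le> s" "s \<le> t"
      have "((\<lambda>s. U (y + s *\<^sub>R v + z)) has_derivative (\<lambda>h. (h *\<^sub>R v) \<bullet> g (y + s *\<^sub>R v + z))) (at s)" for z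
        by (rule has_derivative_compose [OF _ U]) (auto intro!: derivative_eq_intros)
      from this [of "t *\<^sub>R w"] this [of 0]
      show "(?\<psi> has_real_derivative v \<bullet> (g (y + s *\<^sub>R v + t *\<^sub>R w) - g (y + s *\<^sub>R v))) (at s)"
        unfolding has_field_derivative_def
        by (auto intro!: derivative_eq_intros simp: inner_diff_right algebra_simps)
    qed (use t in auto)
    then obtain \<xi> where \<xi>: "0 < \<xi>" "\<xi> < t"
      and \<psi>: "?\<psi> t - ?\<psi> 0 = t * (v \<bullet> (g (y + \<xi> *\<^sub>R v + t *\<^sub>R w) - g (y + \<xi> *\<^sub>R v)))"
      by auto
    define p q where "p = \<xi> *\<^sub>R v + t *\<^sub>R w" and "q = \<xi> *\<^sub>R v"
    have nq: "norm q \<le> t * N"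
      using \<xi> N by (auto simp: q_def intro!: mult_mono)
    have "norm (t *\<^sub>R w) \<le> t * N"
      using \<xi> N by (auto intro!: mult_mono)
    with nq have np: "norm p \<le> 2 * (t * N)"
      unfolding p_def q_def [symmetric] using norm_triangle_ineq [of q "t *\<^sub>R w"] by linarith
    have ep: "norm (g (y + p) - g y - G p) \<le> e' * (2 * (t * N))"
      using gd [of "y + p"] np tN e' by (auto intro: order_trans mult_left_mono)
    have "0 \<le> t * N" using t N by simp
    then have eq: "norm (g (y + q) - g y - G q) \<le> e' * (t * N)"
      using gd [of "y + q"] nq tN e' by (auto intro: order_trans mult_left_mono)
    have Gpq: "G p - G q = t *\<^sub>R G w"
      unfolding p_def q_def using G by (simp add: bounded_linear.linear linear_add linear_scale)
    have "g (y + p) - g (y + q) - t *\<^sub>R G w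
        = (g (y + p) - g y - G p) - (g (y + q) - g y - G q)"
      by (simp add: Gpq [symmetric])
    then have *: "norm (g (y + p) - g (y + q) - t *\<^sub>R G w) \<le> 3 * e' * (t * N)"
      using ep eq norm_triangle_ineq4 [of "g (y + p) - g y - G p" "g (y + q) - g y - G q"]
      by (simp add: algebra_simps)
    have "U (y + t *\<^sub>R v + t *\<^sub>R w) - U (y + t *\<^sub>R v) - U (y + t *\<^sub>R w) + U y - t\<^sup>2 * (v \<bullet> G w)
        = t * (v \<bullet> (g (y + p) - g (y + q) - t *\<^sub>R G w))"
      using \<psi> by (simp add: p_def q_def inner_diff_right algebra_simps power2_eq_square)
    also have "\<bar>\<dots>\<bar> \<le> t * (norm v * norm (g (y + p) - g (y + q) - t *\<^sub>R G w))"
      using t by (simp add: abs_mult Cauchy_Schwarz_ineq2)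
    also have "\<dots> \<le> t * (N * (3 * e' * (t * N)))"
      using t N * by (intro mult_left_mono mult_mono) auto
    also have "\<dots> = (3 * e' * N * N) * t\<^sup>2"
      by (simp add: power2_eq_square)
    finally show "\<bar>U (y + t *\<^sub>R v + t *\<^sub>R w) - U (y + t *\<^sub>R v) - U (y + t *\<^sub>R w) + U y - t\<^sup>2 * (v \<bullet> G w)\<bar>
        \<le> e * t\<^sup>2"
      by (simp only: e')
  qed
qed

text \<open>The second difference is symmetric in \<open>v\<close> and \<open>w\<close>; hence so is its limit after division by \<open>t\<^sup>2\<close>.\<close>

lemma gradient_derivative_symmetric:
  fixes U :: "'a::real_inner \<Rightarrow> real"
  assumes U: "\<And>x. (U has_derivative (\<lambda>h. h \<bullet> g x)) (at x)"
    and g: "(g has_derivative G) (at y)"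
  shows "v \<bullet> G w = G v \<bullet> w"
proof -
  have "\<bar>v \<bullet> G w - w \<bullet> G v\<bar> \<le> e" if "0 < e" for e
  proof -
    have e2: "0 < e / 2" using that by simp
    obtain d1 where d1: "0 < d1" "\<And>t. 0 < t \<Longrightarrow> t < d1 \<Longrightarrow>
        \<bar>U (y + t *\<^sub>R v + t *\<^sub>R w) - U (y + t *\<^sub>R v) - U (y + t *\<^sub>R w) + U y - t\<^sup>2 * (v \<bullet> G w)\<bar> \<le> e / 2 * t\<^sup>2"
      using second_difference_estimate [OF U g e2, of v w] by blast
    obtain d2 where d2: "0 < d2" "\<And>t. 0 < t \<Longrightarrow> t < d2 \<Longrightarrow>
        \<bar>U (y + t *\<^sub>R w + t *\<^sub>R v) - U (y + t *\<^sub>R w) - U (y + t *\<^sub>R v) + U y - t\<^sup>2 * (w \<bullet> G v)\<bar> \<le> e / 2 * t\<^sup>2"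
      using second_difference_estimate [OF U g e2, of w v] by blast
    define t where "t = min d1 d2 / 2"
    have t: "0 < t" "t < d1" "t < d2" using d1 d2 by (auto simp: t_def)
    have sw: "y + t *\<^sub>R w + t *\<^sub>R v = y + t *\<^sub>R v + t *\<^sub>R w" by (simp add: algebra_simps)
    have "\<bar>t\<^sup>2 * (v \<bullet> G w) - t\<^sup>2 * (w \<bullet> G v)\<bar> \<le> e * t\<^sup>2"
      using d1(2) [OF t(1,2)] d2(2) [OF t(1,3)] unfolding sw by linarith
    moreover have "\<bar>t\<^sup>2 * (v \<bullet> G w) - t\<^sup>2 * (w \<bullet> G v)\<bar> = t\<^sup>2 * \<bar>v \<bullet> G w - w \<bullet> G v\<bar>"
      by (simp only: right_diff_distrib [symmetric] abs_mult) simp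
    ultimately have "t\<^sup>2 * \<bar>v \<bullet> G w - w \<bullet> G v\<bar> \<le> t\<^sup>2 * e"
      by (simp add: mult.commute)
    then show ?thesis using t by simp
  qed
  then have "\<bar>v \<bullet> G w - w \<bullet> G v\<bar> \<le> 0"
    by (rule field_le_epsilon [of _ 0, simplified])
  then show ?thesis by (simp add: inner_commute)
qed

section \<open>Symplecticity\<close>

lemma UNIV_sum_split: "(\<Sum>i\<in>(UNIV :: ('a::finite + 'b::finite) set). g i) = (\<Sum>k\<in>UNIV. g (Inl k)) + (\<Sum>k\<in>UNIV. g (Inr k))"
  unfolding UNIV_Plus_UNIV [symmetric] by (subst sum.Plus) (simp_all add: o_def)

lemma J_mat_apply:
  "(J_mat *v x) $ Inl k = x $ Inr k" "(J_mat *v x) $ Inr k = - x $ Inl k"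
  unfolding matrix_vector_mult_def J_mat_def UNIV_sum_split
  by (simp_all add: if_distrib [of "\<lambda>a. a * _"] sum.delta cong: if_cong)

lemma J_mat_J_mat: "J_mat *v (J_mat *v x) = - x"
  unfolding vec_eq_iff
proof
  fix i show "(J_mat *v (J_mat *v x)) $ i = (- x) $ i"
    by (cases i) (simp_all add: J_mat_apply)
qed

lemma inner_J_mat_left: "(J_mat *v x) \<bullet> y = - (x \<bullet> (J_mat *v y))"
  by (simp add: inner_vec_def UNIV_sum_split J_mat_apply sum_negf)

lemma matrix_inv_J_mat: "matrix_inv J_mat = - (J_mat :: real^('m::finite + 'm)^('m + 'm))"
  by (rule matrix_inv_eqI)
    (simp add: matrix_eq matrix_vector_mul_assoc [symmetric] mv.minus_left mv.minus_right J_mat_J_mat)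

definition sympl :: "real^('m::finite + 'm) \<Rightarrow> real^('m + 'm) \<Rightarrow> real" where
  "sympl u v = u \<bullet> (J_mat *v v)"

lemma bounded_bilinear_sympl: "bounded_bilinear sympl"
  unfolding sympl_def
  by (rule bounded_bilinear.comp [OF bounded_bilinear_inner bounded_linear_ident mv.bounded_linear_right])

interpretation sympl: bounded_bilinear sympl
  by (rule bounded_bilinear_sympl)

text \<open>With \<open>G\<close> a Hessian, this is the statement that the derivative of a Hamiltonian vector field belongs to
  the symplectic Lie algebra; with \<open>G = Q\<close> it says so for \<open>M\<close>.\<close>

lemma hamiltonian_skew:
  assumes "\<And>v w. v \<bullet> G w = G v \<bullet> w"
  shows "sympl (matrix_inv J_mat *v G u) v + sympl u (matrix_inv J_mat *v G v) = 0"
  using assms [of u v]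
  by (simp add: sympl_def matrix_inv_J_mat mv.minus_left mv.minus_right inner_J_mat_left J_mat_J_mat)

text \<open>The derivative of \<open>sympl (e\<^sup>t\<^sup>M u) (e\<^sup>t\<^sup>M v)\<close> vanishes by the assumption on \<open>M\<close>.\<close>

lemma mexp_preserves_sympl:
  assumes "\<And>u v. sympl (M *v u) v + sympl u (M *v v) = 0"
  shows "sympl (mexp (t *\<^sub>R M) *v u) (mexp (t *\<^sub>R M) *v v) = sympl u v"
proof -
  let ?F = "\<lambda>t. sympl (mexp (t *\<^sub>R M) *v u) (mexp (t *\<^sub>R M) *v v)"
  have d: "((\<lambda>t. mexp (t *\<^sub>R M) *v w) has_vector_derivative M *v (mexp (t *\<^sub>R M) *v w)) (at t)" for w t
    using bounded_linear.has_vector_derivative [OF mv.bounded_linear_left mexp_has_vector_derivative]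
    by (simp add: matrix_vector_mul_assoc)
  have "(?F has_vector_derivative 0) (at t)" for t
    using sympl.has_vector_derivative [OF d [of u t] d [of v t]] assms by (simp add: add.commute)
  then obtain C where C: "?F t = C" for t
    using has_vector_derivative_zero_constant [of UNIV ?F] by auto
  show ?thesis using C [of t] C [of 0] by simp
qed

lemma symplectic_matrix_iff:
  fixes B :: "real^('m::finite + 'm)^('m + 'm)"
  shows "transpose B ** J_mat ** B = J_mat \<longleftrightarrow> (\<forall>u v. sympl (B *v u) (B *v v) = sympl u v)"
proof -
  have "sympl (B *v u) (B *v v) = u \<bullet> ((transpose B ** J_mat ** B) *v v)" for u v
  proof -
    have "w \<bullet> (transpose B *v z) = (B *v w) \<bullet> z" for w z
      by (metis dot_lmul_matrix inner_commute transpose_matrix_vector)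
    then show ?thesis
      by (simp only: sympl_def matrix_vector_mul_assoc [symmetric])
  qed
  then show ?thesis
    unfolding matrix_eq sympl_def by (metis vector_eq_ldot)
qed

text \<open>One step of the method, with stages \<open>x\<^sub>i\<close> and slopes \<open>k\<^sub>i\<close>, applied to two initial values at once.
  Expanding the left-hand side leaves terms of first order in \<open>h\<close>. In them \<open>u\<close> and \<open>v\<close> are expressed
  through the stages; the skewness assumption then cancels the stages and
  leaves \<open>-h\<^sup>2 \<Sum>\<^sub>i\<^sub>j (b\<^sub>i a\<^sub>i\<^sub>j + b\<^sub>j a\<^sub>j\<^sub>i) \<omega>(k\<^sub>i, k'\<^sub>j)\<close>, which the second order term
  \<open>h\<^sup>2 \<Sum>\<^sub>i\<^sub>j b\<^sub>i b\<^sub>j \<omega>(k\<^sub>i, k'\<^sub>j)\<close> compensates.\<close>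

lemma symplectic_rk_preserves_bilinear:
  fixes \<omega> :: "'a::real_normed_vector \<Rightarrow> 'a \<Rightarrow> real"
  assumes \<omega>: "bounded_bilinear \<omega>" and rk: "rk_symplectic s b A"
    and x: "\<And>i. i \<in> {1..s} \<Longrightarrow> x i = u + h *\<^sub>R (\<Sum>j=1..s. A i j *\<^sub>R k j)"
    and x': "\<And>i. i \<in> {1..s} \<Longrightarrow> x' i = v + h *\<^sub>R (\<Sum>j=1..s. A i j *\<^sub>R k' j)"
    and skew: "\<And>i. i \<in> {1..s} \<Longrightarrow> \<omega> (k i) (x' i) + \<omega> (x i) (k' i) = 0"
  shows "\<omega> (u + h *\<^sub>R (\<Sum>i=1..s. b i *\<^sub>R k i)) (v + h *\<^sub>R (\<Sum>i=1..s. b i *\<^sub>R k' i)) = \<omega> u v"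
proof -
  interpret bounded_bilinear \<omega> by (rule \<omega>)
  let ?W = "\<lambda>i j. \<omega> (k i) (k' j)"
  have kv: "\<omega> (k i) v + \<omega> u (k' i) = - h * (\<Sum>j=1..s. A i j * ?W i j + A i j * ?W j i)"
    if i: "i \<in> {1..s}" for i
  proof -
    have "\<omega> (k i) (x' i) = \<omega> (k i) v + h * (\<Sum>j=1..s. A i j * ?W i j)"
      unfolding x' [OF i] by (simp add: add_right scaleR_right sum_right)
    moreover have "\<omega> (x i) (k' i) = \<omega> u (k' i) + h * (\<Sum>j=1..s. A i j * ?W j i)"
      unfolding x [OF i] by (simp add: add_left scaleR_left sum_left)
    ultimately show ?thesis
      using skew [OF i] by (simp add: sum.distrib algebra_simps)
  qed
  have kk: "\<omega> (\<Sum>i=1..s. b i *\<^sub>R k i) (\<Sum>i=1..s. b i *\<^sub>R k' i) = (\<Sum>i=1..s. \<Sum>j=1..s. b i * b j * ?W i j)"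
    by (simp only: sum_left scaleR_left)
      (simp add: sum_right scaleR_right sum_distrib_left mult.assoc)
  have "\<omega> (u + h *\<^sub>R (\<Sum>i=1..s. b i *\<^sub>R k i)) (v + h *\<^sub>R (\<Sum>i=1..s. b i *\<^sub>R k' i))
      = \<omega> u v + h * (\<Sum>i=1..s. b i * (\<omega> (k i) v + \<omega> u (k' i)))
        + h * (h * (\<Sum>i=1..s. \<Sum>j=1..s. b i * b j * ?W i j))"
    by (simp only: add_left add_right scaleR_left scaleR_right kk)
      (simp add: sum_left sum_right scaleR_left scaleR_right sum.distrib distrib_left)
  also have "(\<Sum>i=1..s. b i * (\<omega> (k i) v + \<omega> u (k' i)))
      = - h * (\<Sum>i=1..s. \<Sum>j=1..s. b i * A i j * ?W i j + b i * A i j * ?W j i)"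
    unfolding sum_distrib_left
    by (intro sum.cong refl, simp only: kv)
      (simp add: sum_distrib_left algebra_simps)
  also have "(\<Sum>i=1..s. \<Sum>j=1..s. b i * A i j * ?W i j + b i * A i j * ?W j i)
      = (\<Sum>i=1..s. \<Sum>j=1..s. b i * A i j * ?W i j) + (\<Sum>i=1..s. \<Sum>j=1..s. b j * A j i * ?W i j)"
    by (simp only: sum.distrib, subst (2) sum.swap) simp
  also have "\<dots> = (\<Sum>i=1..s. \<Sum>j=1..s. b i * b j * ?W i j)"
    unfolding sum.distrib [symmetric] distrib_right [symmetric]
    using rk unfolding rk_symplectic_def by (intro sum.cong refl) simp
  finally show ?thesis by simp
qed

text \<open>The Jacobian applied to \<open>u\<close> is \<open>e\<^sup>h\<^sup>M (u + h \<Sum>\<^sub>i b\<^sub>i k\<^sub>i)\<close>, where \<open>k\<^sub>i = e\<^bsup>-c\<^sub>i h M\<^esup> f'(Y\<^sub>i) D\<^sub>i u\<close> and \<open>D\<^sub>i\<close> is the derivative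
  of the \<open>i\<close>-th stage. With \<open>x\<^sub>i = e\<^bsup>-c\<^sub>i h M\<^esup> D\<^sub>i u\<close> the linearised stage equations become
  \<open>x\<^sub>i = u + h \<Sum>\<^sub>j a\<^sub>i\<^sub>j k\<^sub>j\<close>, so the Runge-Kutta lemma applies.\<close>

theorem SEI_symplectic:
  assumes rk: "rk_symplectic s b A"
  shows "ei_symplectic (SEI s c b A :: ('m::finite + 'm) scheme)"
  unfolding ei_symplectic_def
proof (intro allI impI)
  fix Q M :: "real^('m + 'm)^('m + 'm)" and U gradU
    and f :: "real^('m + 'm) \<Rightarrow> real^('m + 'm)" and y0
  assume Q: "transpose Q = Q" and smooth: "smooth U" and grad: "\<forall>y. GDERIV U y :> gradU y"
    and M: "M = matrix_inv J_mat ** Q" and f: "f = (\<lambda>y. matrix_inv J_mat *v gradU y)"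
  let ?S = "SEI s c b A :: ('m + 'm) scheme"
  have U: "(U has_derivative (\<lambda>h. h \<bullet> gradU y)) (at y)" for y
    using grad by (simp add: gderiv_def)
  have ckU: "ck (Suc (Suc 0)) U"
    using smooth unfolding smooth_def by blast
  have "gradU y = (\<Sum>e\<in>Basis. frechet_derivative U (at y) e *\<^sub>R e)" for y
    using frechet_derivative_at [OF U [of y]]
    by (metis (no_types, lifting) euclidean_representation inner_commute sum.cong)
  moreover have "ck (Suc 0) (\<lambda>y. \<Sum>e\<in>Basis. frechet_derivative U (at y) e *\<^sub>R e)"
    by (intro ck_sum ck_linear_compose [OF bounded_linear_scaleR_left] ck_SucD(2) [OF ckU])
  ultimately have ckg: "ck (Suc 0) gradU"
    by presburger
  have ckf: "ck (Suc 0) f"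
    unfolding f by (rule ck_linear_compose [OF mv.bounded_linear_right ckg])
  define F where "F y = frechet_derivative f (at y)" for y
  have F: "(f has_derivative F y) (at y)" for y
    unfolding F_def by (rule ck_SucD(1) [OF ckf])
  have skewF: "sympl (F y u) v + sympl u (F y v) = 0" for y u v
  proof -
    let ?G = "frechet_derivative gradU (at y)"
    have G: "(gradU has_derivative ?G) (at y)"
      by (rule ck_SucD(1) [OF ckg])
    have "(f has_derivative (\<lambda>v. matrix_inv J_mat *v ?G v)) (at y)"
      unfolding f by (rule bounded_linear.has_derivative [OF mv.bounded_linear_right G])
    then have "F y = (\<lambda>v. matrix_inv J_mat *v ?G v)"
      using F has_derivative_unique by blast
    then show ?thesis
      using hamiltonian_skew [of ?G] gradient_derivative_symmetric [OF U G] by simp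
  qed
  have "v \<bullet> (Q *v w) = (Q *v v) \<bullet> w" for v w
    by (metis Q dot_lmul_matrix transpose_matrix_vector)
  then have "sympl (M *v u) v + sympl u (M *v v) = 0" for u v
    unfolding M using hamiltonian_skew [of "(*v) Q"] by (simp add: matrix_vector_mul_assoc)
  note exp_sympl = mexp_preserves_sympl [OF this]
  obtain L where L: "0 \<le> L"
    and FL: "\<And>x v. x \<in> cball y0 1 \<Longrightarrow> norm (F x v) \<le> L * norm v"
    and lip: "\<And>x x'. \<lbrakk>x \<in> cball y0 1; x' \<in> cball y0 1\<rbrakk> \<Longrightarrow> norm (f x - f x') \<le> L * norm (x - x')"
    using ck_1_lipschitz_on_cball [OF ckf] unfolding F_def by metis
  \<comment> \<open>Any radius would do, as \<open>f\<close> is \<open>C\<^sup>1\<close> everywhere; radius 1 makes the stages lie within \<open>1/2\<close> of \<open>y\<close>.\<close>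
  have sys: "\<forall>\<^sub>F h in at 0. stage_system {1..s} (\<lambda>i. matrix_blinfun (mexp (c i *\<^sub>R h *\<^sub>R M)))
      (\<lambda>i j. h *\<^sub>R A i j *\<^sub>R matrix_blinfun (mexp ((c i - c j) *\<^sub>R h *\<^sub>R M)))
      f y0 1 L (norm (f y0) + L * 1)"
    by (rule SEI_stage_system) (use L lip in auto)
  have "\<forall>\<^sub>F h in at 0. (\<forall>\<^sub>F y in nhds y0. \<exists>!Y. ei_stages ?S M f (1 / 2) h y Y) \<and>
      ei_step ?S M f (1 / 2) h differentiable (at y0) \<and>
      transpose (jacobian (ei_step ?S M f (1 / 2) h) (at y0)) ** J_mat **
        jacobian (ei_step ?S M f (1 / 2) h) (at y0) = J_mat"
    using sys
  proof eventually_elim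
    case (elim h)
    define E where "E a = mexp (a *\<^sub>R h *\<^sub>R M)" for a
    have E_add: "E a *v (E a' *v w) = E (a + a') *v w" for a a' w
      using mexp_add [of a "h *\<^sub>R M" a'] by (simp add: E_def matrix_vector_mul_assoc)
    have E_0: "E 0 *v w = w" for w
      by (simp add: E_def)
    have E_sympl: "sympl (E a *v u) (E a *v v) = sympl u v" for a u v
      using exp_sympl [of "a * h"] by (simp add: E_def)
    define P where "P i = matrix_blinfun (E (c i))" for i
    define T where "T i j = h *\<^sub>R A i j *\<^sub>R matrix_blinfun (E (c i - c j))" for i j
    interpret stage_system "{1..s}" P T f y0 1 L "norm (f y0) + L * 1"
      using elim unfolding P_def T_def E_def .
    have iff: "is_stages y Y \<longleftrightarrow> ei_stages ?S M f (1 / 2) h y Y" for y Y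
      using SEI_is_stages_iff [OF elim, of y Y b] unfolding P_def T_def E_def .
    have near: "\<forall>\<^sub>F y in nhds y0. y \<in> ball y0 (1 / 2)"
      using y0_in by (intro eventually_nhds_in_open) auto
    have ex: "\<forall>\<^sub>F y in nhds y0. \<exists>!Y. ei_stages ?S M f (1 / 2) h y Y"
      using near by eventually_elim (use ex1_stages iff in simp)
    have THE_eq: "(THE Y. ei_stages ?S M f (1 / 2) h y Y) = stages y" for y
      unfolding stages_def iff ..
    have step: "ei_step ?S M f (1 / 2) h y
        = E 1 *v y + h *\<^sub>R (\<Sum>i=1..s. b i *\<^sub>R (E (1 - c i) *v f (stages y i)))" for y
      unfolding ei_step_def THE_eq by (simp add: update_def E_def mv.scaleR_left)
    define FY where "FY i = Blinfun (F (stages y0 i))" for i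
    have FY: "blinfun_apply (FY i) = F (stages y0 i)" for i
      unfolding FY_def by (rule bounded_linear_Blinfun_apply [OF has_derivative_bounded_linear [OF F]])
    obtain D where D: "\<And>i. i \<in> {1..s} \<Longrightarrow> D i = P i + (\<Sum>j\<in>{1..s}. T i j o\<^sub>L (FY j o\<^sub>L D j))"
      and der: "\<And>i. i \<in> {1..s} \<Longrightarrow> ((\<lambda>y. stages y i) has_derivative blinfun_apply (D i)) (at y0)"
    proof (rule stages_has_derivative [of FY])
      fix i assume i: "i \<in> {1..s}"
      show "(f has_derivative blinfun_apply (FY i)) (at (stages y0 i))"
        unfolding FY by (rule F)
      show "norm (FY i) \<le> L"
        using stages_in [OF y0_in i] L by (intro norm_blinfun_bound) (auto simp: FY intro: FL)
    qed (rule that)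
    define \<Phi>' where "\<Phi>' v = E 1 *v v + h *\<^sub>R (\<Sum>i=1..s. b i *\<^sub>R (E (1 - c i) *v F (stages y0 i) (D i v)))" for v
    have \<Phi>': "(ei_step ?S M f (1 / 2) h has_derivative \<Phi>') (at y0)"
      unfolding step [abs_def] \<Phi>'_def [abs_def]
      by (intro has_derivative_add bounded_linear_imp_has_derivative mv.bounded_linear_right
          bounded_linear.has_derivative [OF bounded_linear_scaleR_right] has_derivative_sum
          bounded_linear.has_derivative [OF mv.bounded_linear_right]
          has_derivative_compose [OF der F])
    have sympl\<Phi>': "sympl (\<Phi>' u) (\<Phi>' v) = sympl u v" for u v
    proof -
      \<comment> \<open>In the transformed variables the propagators disappear from the stage equations.\<close>
      define x where "x w i = E (- c i) *v D i w" for w i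
      define k where "k w i = E (- c i) *v F (stages y0 i) (D i w)" for w i
      have x: "x w i = w + h *\<^sub>R (\<Sum>j=1..s. A i j *\<^sub>R k w j)" if i: "i \<in> {1..s}" for w i
        unfolding x_def k_def
        by (subst D [OF i])
          (simp add: P_def T_def FY blinfun.add_left blinfun.sum_left blinfun.scaleR_left
            mv.add_right mv.sum_right mv.scaleR_right E_add E_0 scaleR_sum_right)
      have \<Phi>'_eq: "\<Phi>' w = E 1 *v (w + h *\<^sub>R (\<Sum>i=1..s. b i *\<^sub>R k w i))" for w
        unfolding \<Phi>'_def k_def
        by (simp add: mv.add_right mv.sum_right mv.scaleR_right E_add)
      have "sympl (k u i) (x v i) + sympl (x u i) (k v i) = 0" for i
        by (simp add: x_def k_def E_sympl skewF)
      then show ?thesis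
        unfolding \<Phi>'_eq E_sympl
        by (intro symplectic_rk_preserves_bilinear [OF bounded_bilinear_sympl rk x x])
    qed
    have "jacobian (ei_step ?S M f (1 / 2) h) (at y0) *v w = \<Phi>' w" for w
      unfolding jacobian_def frechet_derivative_at [OF \<Phi>', symmetric]
      using matrix_vector_mul(3) [OF has_derivative_bounded_linear [OF \<Phi>']] by metis
    then show ?case
      using ex \<Phi>' sympl\<Phi>' by (auto simp: symplectic_matrix_iff differentiable_def)
  qed
  then show "\<exists>r>0. \<forall>\<^sub>F h in at 0. (\<forall>\<^sub>F y in nhds y0. \<exists>!Y. ei_stages ?S M f r h y Y) \<and>
      ei_step ?S M f r h differentiable (at y0) \<and>
      transpose (jacobian (ei_step ?S M f r h) (at y0)) ** J_mat **
        jacobian (ei_step ?S M f r h) (at y0) = J_mat"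
    by (intro exI [of _ "1 / 2"]) simp
qed

section \<open>Order\<close>

text \<open>The vector field of the transformed problem: \<open>y\<close> solves \<open>y' = M y + f(y)\<close> if and only if
  \<open>z(t) = e\<^bsup>-(t - t\<^sub>0)M\<^esup> y(t)\<close> solves \<open>z' = rk_field M f t\<^sub>0 t z\<close>.\<close>

definition rk_field :: "real^'n^'n \<Rightarrow> (real^'n \<Rightarrow> real^'n) \<Rightarrow> real \<Rightarrow> real \<Rightarrow> real^'n \<Rightarrow> real^'n" where
  "rk_field M f t0 t x = mexp ((t0 - t) *\<^sub>R M) *v f (mexp ((t - t0) *\<^sub>R M) *v x)"

lemma ck_rk_field:
  fixes M :: "real^'n^'n" and f :: "real^'n \<Rightarrow> real^'n"
  assumes "ck k f"
  shows "ck k (\<lambda>(t, x). rk_field M f t0 t x)"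
proof -
  have time: "ck k (\<lambda>p::real \<times> (real^'n). fst p - t0)"
    using ck_add [OF ck_bounded_linear [OF bounded_linear_fst] ck_const [of k "- t0"]] by simp
  have time': "ck k (\<lambda>p::real \<times> (real^'n). t0 - fst p)"
    using ck_linear_compose [OF bounded_linear_minus [OF bounded_linear_ident] time] by simp
  have snd: "ck k (snd :: real \<times> (real^'n) \<Rightarrow> real^'n)"
    by (rule ck_bounded_linear [OF bounded_linear_snd])
  have "ck k (\<lambda>p. mexp ((t0 - fst p) *\<^sub>R M) *v f (mexp ((fst p - t0) *\<^sub>R M) *v snd p))"
    by (intro ck_bilinear [OF bounded_bilinear_matrix_vector] ck_compose [OF ck_mexp_line]
        ck_compose [OF assms] time time' snd)
  then show ?thesis
    by (simp add: rk_field_def case_prod_unfold)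
qed

lemma transformed_solution:
  assumes "(y has_vector_derivative M *v y t + f (y t)) (at t)"
  shows "((\<lambda>t. mexp ((t0 - t) *\<^sub>R M) *v y t) has_vector_derivative
      rk_field M f t0 t (mexp ((t0 - t) *\<^sub>R M) *v y t)) (at t)"
proof -
  have "((\<lambda>t. mexp ((t0 - t) *\<^sub>R M)) has_vector_derivative
      (- 1) *\<^sub>R (M ** mexp ((t0 - t) *\<^sub>R M))) (at t)"
    by (rule mexp_has_vector_derivative_comp) (auto intro!: derivative_eq_intros)
  note deriv = mv.has_vector_derivative [OF this assms]
  have cancel: "mexp ((t - t0) *\<^sub>R M) ** mexp ((t0 - t) *\<^sub>R M) = mat 1"
    by (simp add: mexp_add)
  show ?thesis
    using deriv unfolding mexp_commute
    by (simp add: rk_field_def matrix_vector_mul_assoc cancel mv.minus_left mv.add_right)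
qed

text \<open>The Runge-Kutta method is applied to the transformed problem. Its stages are unique in some ball of
  radius \<open>r\<close>; the integrator's stages are taken in the ball of radius \<open>r/2\<close>, so that their
  transforms still lie in the larger ball for small \<open>h\<close> and therefore are the Runge-Kutta stages.
  Taking at least \<open>C\<^sup>1\<close> smoothness provides the Lipschitz constant for the stage equations.\<close>

theorem SEI_order:
  assumes rk: "rk_order TYPE('n) s c b A p"
  shows "ei_order (SEI s c b A :: 'n::finite scheme) p"
proof -
  let ?S = "SEI s c b A :: 'n scheme"
  obtain k where k: "\<And>(g :: real \<Rightarrow> real^'n \<Rightarrow> real^'n) y t0 \<epsilon>.
      \<lbrakk>ck k (\<lambda>(t, x). g t x); \<epsilon> > 0;
       \<forall>t\<in>{t0 - \<epsilon><..<t0 + \<epsilon>}. (y has_vector_derivative g t (y t)) (at t)\<rbrakk> \<Longrightarrow>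
      \<exists>r>0. (\<forall>\<^sub>F h in at 0. \<exists>!Y. rk_stages s c A g r h t0 (y t0) Y) \<and>
        (\<lambda>h. norm (rk_step s c b A g r h t0 (y t0) - y (t0 + h))) \<in> O[at 0](\<lambda>h. h ^ (p + 1))"
    using rk unfolding rk_order_def by blast
  show ?thesis
    unfolding ei_order_def
  proof (intro exI [of _ "max k (Suc 0)"] allI impI)
    fix M :: "real^'n^'n" and f :: "real^'n \<Rightarrow> real^'n" and y t0 \<epsilon>
    assume f: "ck (max k (Suc 0)) f" and \<epsilon>: "0 < \<epsilon>"
      and ode: "\<forall>t\<in>{t0 - \<epsilon><..<t0 + \<epsilon>}. (y has_vector_derivative (M *v y t + f (y t))) (at t)"
    define E where "E a = mexp (a *\<^sub>R M)" for a
    have E_add: "E a *v (E a' *v w) = E (a + a') *v w" for a a' w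
      using mexp_add [of a M a'] by (simp add: E_def matrix_vector_mul_assoc)
    have E_0: "E 0 *v w = w" for w
      by (simp add: E_def)
    have E_inj: "E a *v w = E a *v w' \<longleftrightarrow> w = w'" for a w w'
      using E_add [of "- a" a] E_0 by (metis add.left_inverse)
    have E_cont: "((\<lambda>h. E (a * h)) \<longlongrightarrow> mat 1) (at 0)" for a
      using tendsto_mexp_at_0 [of a M] by (simp add: E_def)
    define g where "g = rk_field M f t0"
    have g: "g (t0 + t) x = E (- t) *v f (E t *v x)" for t x
      by (simp add: g_def rk_field_def E_def)
    define z where "z t = E (t0 - t) *v y t" for t
    have z0: "z t0 = y t0"
      by (simp add: z_def E_0)
    have "\<forall>t\<in>{t0 - \<epsilon><..<t0 + \<epsilon>}. (z has_vector_derivative g t (z t)) (at t)"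
      using ode transformed_solution [of y M _ f t0] by (simp add: z_def [abs_def] E_def g_def)
    from k [OF ck_rk_field [OF ck_antimono [OF max.cobounded1 f], of M t0, folded g_def] \<epsilon> this]
    obtain r where r: "0 < r" and ex_rk: "\<forall>\<^sub>F h in at 0. \<exists>!Z. rk_stages s c A g r h t0 (y t0) Z"
      and err: "(\<lambda>h. norm (rk_step s c b A g r h t0 (y t0) - z (t0 + h))) \<in> O[at 0](\<lambda>h. h ^ (p + 1))"
      unfolding z0 by blast
    obtain L where L: "0 \<le> L"
      and lip: "\<And>x x'. \<lbrakk>x \<in> cball (y t0) r; x' \<in> cball (y t0) r\<rbrakk> \<Longrightarrow> norm (f x - f x') \<le> L * norm (x - x')"
      using ck_1_lipschitz_on_cball [OF ck_antimono [OF max.cobounded2 f]] by metis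
    have sys: "\<forall>\<^sub>F h in at 0. stage_system {1..s} (\<lambda>i. matrix_blinfun (mexp (c i *\<^sub>R h *\<^sub>R M)))
        (\<lambda>i j. h *\<^sub>R A i j *\<^sub>R matrix_blinfun (mexp ((c i - c j) *\<^sub>R h *\<^sub>R M)))
        f (y t0) r L (norm (f (y t0)) + L * r)"
      by (rule SEI_stage_system) (use r L lip in auto)
    have ex_ei: "\<forall>\<^sub>F h in at 0. \<exists>!Y. ei_stages ?S M f (r / 2) h (y t0) Y"
      using sys
    proof eventually_elim
      case (elim h)
      then show ?case
        using stage_system.ex1_stages [OF elim stage_system.y0_in [OF elim]]
        by (simp only: SEI_is_stages_iff [OF elim, of _ _ b])
    qed
    have near: "\<forall>\<^sub>F h in at 0. \<forall>i\<in>{1..s}.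
        norm (matrix_blinfun (E (- c i * h)) - id_blinfun) * (norm (y t0) + r) < r / 2"
    proof (intro eventually_ball_finite ballI order_tendstoD(2))
      fix i
      have "((\<lambda>h. matrix_blinfun (E (- c i * h))) \<longlongrightarrow> matrix_blinfun (mat 1)) (at 0)"
        by (rule bounded_linear.tendsto [OF bounded_linear_matrix_blinfun E_cont])
      moreover have "matrix_blinfun (mat 1 :: real^'n^'n) = id_blinfun"
        by (rule blinfun_eqI) simp
      ultimately show "((\<lambda>h. norm (matrix_blinfun (E (- c i * h)) - id_blinfun) * (norm (y t0) + r)) \<longlongrightarrow> 0) (at 0)"
        by (intro tendsto_mult_left_zero tendsto_norm_zero LIM_zero) simp
    qed (use r in auto)
    have step: "\<forall>\<^sub>F h in at 0. ei_step ?S M f (r / 2) h (y t0) - y (t0 + h)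
        = E h *v (rk_step s c b A g r h t0 (y t0) - z (t0 + h))"
      using ex_rk ex_ei near
    proof eventually_elim
      case (elim h)
      define Y where "Y = (THE Y. ei_stages ?S M f (r / 2) h (y t0) Y)"
      have Y: "ei_stages ?S M f (r / 2) h (y t0) Y"
        unfolding Y_def by (rule theI' [OF elim(2)])
      have Yball: "Y i \<in> ball (y t0) (r / 2)" if "i \<in> {1..s}" for i
        using Y that unfolding ei_stages_def by auto
      have Yeq: "Y i = E (c i * h) *v y t0 + h *\<^sub>R (\<Sum>j=1..s. A i j *\<^sub>R (E ((c i - c j) * h) *v f (Y j)))"
        if "i \<in> {1..s}" for i
        using Y that unfolding ei_stages_def stage_eqs_def by (simp add: E_def mv.scaleR_left)
      \<comment> \<open>The transformed stages; outside \<open>{1..s}\<close> they take the default value that an extensional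
        function must have.\<close>
      define Z where "Z = restrict (\<lambda>i. E (- c i * h) *v Y i) {1..s}"
      have EZ: "E (c i * h) *v Z i = Y i" if "i \<in> {1..s}" for i
        using that by (simp add: Z_def E_add E_0)
      have gZ: "g (t0 + c i * h) (Z i) = E (- c i * h) *v f (Y i)" if "i \<in> {1..s}" for i
        using EZ [OF that] by (simp add: g)
      have "rk_stages s c A g r h t0 (y t0) Z"
        unfolding rk_stages_def
      proof (intro conjI ballI PiE_I)
        fix i assume i: "i \<in> {1..s}"
        have nY: "norm (Y i) \<le> norm (y t0) + r"
          using Yball [OF i] r norm_triangle_ineq2 [of "Y i" "y t0"]
          by (simp add: dist_norm norm_minus_commute)
        have "norm (Z i - Y i) \<le> norm (matrix_blinfun (E (- c i * h)) - id_blinfun) * norm (Y i)"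
          using norm_blinfun [of "matrix_blinfun (E (- c i * h)) - id_blinfun" "Y i"] i
          by (simp add: Z_def blinfun.diff_left)
        also have "\<dots> \<le> norm (matrix_blinfun (E (- c i * h)) - id_blinfun) * (norm (y t0) + r)"
          by (intro mult_left_mono nY) simp
        also have "\<dots> < r / 2"
          using elim(3) i by blast
        finally show "Z i \<in> ball (y t0) r"
          using Yball [OF i] dist_triangle [of "y t0" "Z i" "Y i"]
          by (simp add: dist_norm norm_minus_commute)
        have "Z i = E (- c i * h) *v Y i"
          using i by (simp add: Z_def)
        also have "\<dots> = y t0 + h *\<^sub>R (\<Sum>j=1..s. A i j *\<^sub>R (E (- c j * h) *v f (Y j)))"
          unfolding Yeq [OF i]
          by (simp add: mv.add_right mv.scaleR_right mv.sum_right E_add E_0 algebra_simps)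
        finally show "Z i = y t0 + h *\<^sub>R (\<Sum>j=1..s. A i j *\<^sub>R g (t0 + c j * h) (Z j))"
          by (simp add: gZ)
      qed (auto simp: Z_def)
      then have "(THE Z. rk_stages s c A g r h t0 (y t0) Z) = Z"
        by (rule the1_equality [OF elim(1)])
      then have "rk_step s c b A g r h t0 (y t0) = y t0 + h *\<^sub>R (\<Sum>i=1..s. b i *\<^sub>R (E (- c i * h) *v f (Y i)))"
        by (simp add: rk_step_def Let_def gZ)
      then have "E h *v rk_step s c b A g r h t0 (y t0)
          = E h *v y t0 + h *\<^sub>R (\<Sum>i=1..s. b i *\<^sub>R (E ((1 - c i) * h) *v f (Y i)))"
        by (simp add: mv.add_right mv.scaleR_right mv.sum_right E_add left_diff_distrib)
      also have "\<dots> = ei_step ?S M f (r / 2) h (y t0)"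
        by (simp add: ei_step_def Y_def [symmetric] update_def E_def mv.scaleR_left)
      finally show ?case
        by (simp add: mv.diff_right z_def E_add E_0)
    qed
    have "(\<lambda>h. norm (ei_step ?S M f (r / 2) h (y t0) - y (t0 + h))) \<in> O[at 0](\<lambda>h. h ^ (p + 1))"
    proof -
      have "((\<lambda>h. norm (matrix_blinfun (E (1 * h)))) \<longlongrightarrow> norm (matrix_blinfun (mat 1 :: real^'n^'n))) (at 0)"
        by (intro tendsto_norm bounded_linear.tendsto [OF bounded_linear_matrix_blinfun] E_cont)
      then have "\<forall>\<^sub>F h in at 0. norm (matrix_blinfun (E h)) < norm (matrix_blinfun (mat 1 :: real^'n^'n)) + 1"
        by (intro order_tendstoD(2)) auto
      with step have "\<forall>\<^sub>F h in at 0. norm (norm (ei_step ?S M f (r / 2) h (y t0) - y (t0 + h)))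
          \<le> (norm (matrix_blinfun (mat 1 :: real^'n^'n)) + 1)
            * norm (norm (rk_step s c b A g r h t0 (y t0) - z (t0 + h)))"
      proof eventually_elim
        case (elim h)
        show ?case
          unfolding elim(1)
          using order_trans [OF norm_blinfun [of "matrix_blinfun (E h)"] mult_right_mono [OF less_imp_le [OF elim(2)] norm_ge_zero]]
          by simp
      qed
      then have "(\<lambda>h. norm (ei_step ?S M f (r / 2) h (y t0) - y (t0 + h)))
          \<in> O[at 0](\<lambda>h. norm (rk_step s c b A g r h t0 (y t0) - z (t0 + h)))"
        by (rule bigoI)
      then show ?thesis using err by (rule landau_o.big_trans)
    qed
    then show "\<exists>r>0. (\<forall>\<^sub>F h in at 0. \<exists>!Y. ei_stages ?S M f r h (y t0) Y) \<and>
        (\<lambda>h. norm (ei_step ?S M f r h (y t0) - y (t0 + h))) \<in> O[at 0](\<lambda>h. h ^ (p + 1))"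
      using ex_ei r by (intro exI [of _ "r / 2"]) simp
  qed
qed

section \<open>Inheritance of symmetry, symplecticity and order\<close>

theorem theorem3p2:
  fixes s p :: nat and c b :: "nat \<Rightarrow> real" and A :: "nat \<Rightarrow> nat \<Rightarrow> real"
  assumes "s \<ge> 1"
  shows "(rk_symmetric s c b A \<longrightarrow> ei_symmetric (SEI s c b A :: 'n::finite scheme)) \<and>
         (rk_symplectic s b A \<longrightarrow> ei_symplectic (SEI s c b A :: ('m::finite + 'm) scheme)) \<and>
         (rk_symmetric s c b A \<and> rk_symplectic s b A \<longrightarrow>
            ei_symmetric (SEI s c b A :: 'n scheme) \<and>
            ei_symplectic (SEI s c b A :: ('m + 'm) scheme)) \<and>
         (rk_order TYPE('n) s c b A p \<longrightarrow> ei_order (SEI s c b A :: 'n scheme) p)"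
  using SEI_symmetric SEI_symplectic SEI_order by blast

end
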